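(* Let $\mathbb{R}^2\times S^1$ be the Riemannian product of the Euclidean plane and the circle $S^1$. (i) For any immersed 2-torus in $\mathbb{R}^2\times S^1$, $W(T^2)>0$. (ii) For $t>0$, the Willmore functional of the torus $x_t(u,v)=(t\cos u,t\sin u,\cos v,\sin v)$ in $\mathbb{R}^2\times S^1$ is $W(x_t)=\frac{\pi^2}{t}$, which tends to $0$ as $t\to\infty$. Consequently, there exists no torus in $\mathbb{R}^2\times S^1$ having the least Willmore functional $W(T^2)$ among immersed tori.
   Context: $S^1\subset\mathbb{R}^2$ is the unit circle with its standard metric $g_{S^1}$; $\mathbb{R}^2\times S^1\subset\mathbb{R}^2\times\mathbb{R}^2$ carries the product metric $g_{\mathbb{R}^2}\times g_{S^1}$. $T^2$ denotes the 2-dimensional torus; in $x_t$, $u,v\in\mathbb{R}/2\pi\mathbb{Z}$. For an immersed surface $x:M\to N$ in a Riemannian manifold, with the induced metric on $M$, $II$ is the second fundamental form, $\vec H=\frac12\,\mathrm{tr}\,II$ is the mean curvature vector, $K$ is the Gauss curvature of the induced metric, $\tilde K$ is the sectional curvature of $N$ on the tangent plane of the immersed surface, and $dM$ is the induced area element. The Willmore functional is $W(x)=\int_M(|\vec H|^2-K+\tilde K)\,dM$. *)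

theory Defs
  imports "HOL-Analysis.Analysis"
begin

type_synonym plane = "real \<times> real"

abbreviation dir_deriv ::
    "('a::real_normed_vector \<Rightarrow> 'b::real_normed_vector) \<Rightarrow> 'a \<Rightarrow> 'a \<Rightarrow> 'b"
  where "dir_deriv f p X \<equiv> frechet_derivative f (at p) X"

fun C_k :: "nat \<Rightarrow> ('a::euclidean_space \<Rightarrow> 'b::euclidean_space) \<Rightarrow> bool" where
  "C_k 0 f \<longleftrightarrow> continuous_on UNIV f"
| "C_k (Suc k) f \<longleftrightarrow>
     (\<forall>p. f differentiable (at p)) \<and> (\<forall>X. C_k k (\<lambda>p. dir_deriv f p X))"

definition smooth :: "('a::euclidean_space \<Rightarrow> 'b::euclidean_space) \<Rightarrow> bool"
  where "smooth f \<longleftrightarrow> (\<forall>k. C_k k f)"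

text \<open>
  Riemannian metrics on a Euclidean coordinate space: \<open>g p X Y\<close> is the inner product of the
  tangent vectors \<open>X\<close> and \<open>Y\<close> at the point \<open>p\<close>.
\<close>

type_synonym 'a metric = "'a \<Rightarrow> 'a \<Rightarrow> 'a \<Rightarrow> real"

text \<open>
  \<open>sharp b \<alpha>\<close> is the vector dual to the linear form \<open>\<alpha>\<close> with respect to the inner product \<open>b\<close>
  (raising an index).
\<close>

definition sharp :: "('a::euclidean_space \<Rightarrow> 'a \<Rightarrow> real) \<Rightarrow> ('a \<Rightarrow> real) \<Rightarrow> 'a"
  where "sharp b \<alpha> = (THE w. \<forall>Z. b w Z = \<alpha> Z)"

text \<open>
  The dual of \<open>\<lambda>w. i \<bullet> w\<close> is \<open>\<Sum>j. b\<^sup>i\<^sup>j j\<close> with \<open>b\<^sup>i\<^sup>j\<close> the inverse Gram matrix, so this is the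
  contraction \<open>\<Sum>i j. b\<^sup>i\<^sup>j B i j\<close>.
\<close>

definition metric_trace ::
    "('a::euclidean_space \<Rightarrow> 'a \<Rightarrow> real) \<Rightarrow> ('a \<Rightarrow> 'a \<Rightarrow> 'b::real_vector) \<Rightarrow> 'b"
  where "metric_trace b B = (\<Sum>i\<in>Basis. B i (sharp b (\<lambda>w. i \<bullet> w)))"

text \<open>
  Christoffel symbols, by the Koszul formula for constant (hence commuting) vector fields:
  \<open>christoffel g p X Y\<close> is \<open>\<Sum>k. \<Gamma>\<^sup>k\<^sub>i\<^sub>j X\<^sup>i Y\<^sup>j\<close>.
\<close>

definition christoffel :: "'a::euclidean_space metric \<Rightarrow> 'a \<Rightarrow> 'a \<Rightarrow> 'a \<Rightarrow> 'a"
  where "christoffel g p X Y =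
    sharp (g p) (\<lambda>Z. (dir_deriv (\<lambda>q. g q Y Z) p X + dir_deriv (\<lambda>q. g q X Z) p Y
                       - dir_deriv (\<lambda>q. g q X Y) p Z) / 2)"

text \<open>Levi-Civita derivative, at \<open>p\<close>, of the vector field \<open>V\<close> in the direction \<open>X\<close>.\<close>

definition cov_deriv :: "'a::euclidean_space metric \<Rightarrow> 'a \<Rightarrow> ('a \<Rightarrow> 'a) \<Rightarrow> 'a \<Rightarrow> 'a"
  where "cov_deriv g X V p = dir_deriv V p X + christoffel g p X (V p)"

text \<open>
  \<open>R(X, Y) Z = \<nabla>\<^sub>X \<nabla>\<^sub>Y Z - \<nabla>\<^sub>Y \<nabla>\<^sub>X Z\<close>; the term \<open>\<nabla>\<^bsub>[X, Y]\<^esub> Z\<close> vanishes because \<open>X\<close>, \<open>Y\<close>, \<open>Z\<close>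
  are extended to constant vector fields.
\<close>

definition riemann :: "'a::euclidean_space metric \<Rightarrow> 'a \<Rightarrow> 'a \<Rightarrow> 'a \<Rightarrow> 'a \<Rightarrow> 'a"
  where "riemann g p X Y Z =
    cov_deriv g X (cov_deriv g Y (\<lambda>_. Z)) p - cov_deriv g Y (cov_deriv g X (\<lambda>_. Z)) p"

definition gram_det :: "('a \<Rightarrow> 'a \<Rightarrow> real) \<Rightarrow> 'a \<Rightarrow> 'a \<Rightarrow> real"
  where "gram_det b X Y = b X X * b Y Y - (b X Y)\<^sup>2"

definition sectional_curvature :: "'a::euclidean_space metric \<Rightarrow> 'a \<Rightarrow> 'a \<Rightarrow> 'a \<Rightarrow> real"
  where "sectional_curvature g p X Y = g p (riemann g p X Y Y) X / gram_det (g p) X Y"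

definition induced_metric ::
    "('a::euclidean_space \<Rightarrow> 'b::euclidean_space) \<Rightarrow> 'a metric"
  where "induced_metric f p X Y = dir_deriv f p X \<bullet> dir_deriv f p Y"

text \<open>
  The ambient manifold, the product of the plane and the unit circle. The inner product of a
  product type is the sum of the inner products of the factors, so the product metric is the
  restriction of the inner product of the type \<open>plane \<times> plane\<close>.
\<close>

definition plane_circle :: "(plane \<times> plane) set"
  where "plane_circle = UNIV \<times> sphere 0 1"

definition tangent_space :: "plane \<times> plane \<Rightarrow> (plane \<times> plane) set"
  where "tangent_space p = UNIV \<times> {z. z \<bullet> snd p = 0}"

text \<open>The universal covering, every local restriction of which inverts a chart of the manifold.\<close>

definition covering :: "plane \<times> real \<Rightarrow> plane \<times> plane"
  where "covering q = (fst q, (cos (snd q), sin (snd q)))"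

text \<open>
  Sectional curvature of the ambient manifold at \<open>p\<close> on the plane spanned by the tangent vectors
  \<open>V\<close> and \<open>W\<close>, computed in any of the local coordinate systems given by \<open>covering\<close> (the value does
  not depend on which, as they differ by translations of the angle).
\<close>

definition ambient_curvature ::
    "plane \<times> plane \<Rightarrow> plane \<times> plane \<Rightarrow> plane \<times> plane \<Rightarrow> real"
  where "ambient_curvature p V W =
    (THE k. \<exists>q X Y. covering q = p \<and> dir_deriv covering q X = V \<and> dir_deriv covering q Y = W \<and>
       k = sectional_curvature (induced_metric covering) q X Y)"

text \<open>
  Immersed tori. Maps on \<open>(\<real> / 2\<pi>\<int>)\<^sup>2\<close> are maps on \<open>\<real>\<^sup>2\<close> that are \<open>2\<pi>\<close>-periodic in both variables.
\<close>

definition torus_immersion :: "(real \<times> real \<Rightarrow> plane \<times> plane) \<Rightarrow> bool"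
  where "torus_immersion x \<longleftrightarrow>
    smooth x \<and>
    (\<forall>u v. x (u + 2 * pi, v) = x (u, v) \<and> x (u, v + 2 * pi) = x (u, v)) \<and>
    range x \<subseteq> plane_circle \<and>
    (\<forall>p. inj (frechet_derivative x (at p)))"

definition orth_proj :: "'a::euclidean_space set \<Rightarrow> 'a \<Rightarrow> 'a"
  where "orth_proj S w = (THE y. y \<in> S \<and> (\<forall>z\<in>S. (w - y) \<bullet> z = 0))"

definition normal_space ::
    "(real \<times> real \<Rightarrow> plane \<times> plane) \<Rightarrow> real \<times> real \<Rightarrow> (plane \<times> plane) set"
  where "normal_space x p = {w \<in> tangent_space (x p). \<forall>X. w \<bullet> dir_deriv x p X = 0}"

text \<open>
  The Levi-Civita connection of the ambient manifold is the tangential part of the flat derivative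
  of \<open>plane \<times> plane\<close>; the second fundamental form is the part of it normal to the surface.
\<close>

definition second_ff ::
    "(real \<times> real \<Rightarrow> plane \<times> plane) \<Rightarrow> real \<times> real \<Rightarrow> real \<times> real \<Rightarrow> real \<times> real \<Rightarrow> plane \<times> plane"
  where "second_ff x p X Y =
    orth_proj (normal_space x p)
      (orth_proj (tangent_space (x p)) (dir_deriv (\<lambda>q. dir_deriv x q Y) p X))"

definition mean_curvature ::
    "(real \<times> real \<Rightarrow> plane \<times> plane) \<Rightarrow> real \<times> real \<Rightarrow> plane \<times> plane"
  where "mean_curvature x p = (1/2) *\<^sub>R metric_trace (induced_metric x p) (second_ff x p)"

definition gauss_curvature :: "(real \<times> real \<Rightarrow> plane \<times> plane) \<Rightarrow> real \<times> real \<Rightarrow> real"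
  where "gauss_curvature x p = sectional_curvature (induced_metric x) p (1, 0) (0, 1)"

definition tangent_plane_curvature ::
    "(real \<times> real \<Rightarrow> plane \<times> plane) \<Rightarrow> real \<times> real \<Rightarrow> real"
  where "tangent_plane_curvature x p =
    ambient_curvature (x p) (dir_deriv x p (1, 0)) (dir_deriv x p (0, 1))"

definition area_density :: "(real \<times> real \<Rightarrow> plane \<times> plane) \<Rightarrow> real \<times> real \<Rightarrow> real"
  where "area_density x p = sqrt (gram_det (induced_metric x p) (1, 0) (0, 1))"

definition willmore :: "(real \<times> real \<Rightarrow> plane \<times> plane) \<Rightarrow> real"
  where "willmore x =
    integral (cbox (0, 0) (2 * pi, 2 * pi))
      (\<lambda>p. ((norm (mean_curvature x p))\<^sup>2 - gauss_curvature x p + tangent_plane_curvature x p)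
            * area_density x p)"

definition product_torus :: "real \<Rightarrow> real \<times> real \<Rightarrow> plane \<times> plane"
  where "product_torus t = (\<lambda>(u, v). ((t * cos u, t * sin u), (cos v, sin v)))"

end

theory Submission
  imports Defs
begin

text \<open>
  The ambient manifold \<open>\<real>\<^sup>2 \<times> S\<^sup>1\<close> is flat, so its curvature drops out of the Willmore integrand. The
  Gauss curvature integrates to zero, because the torus has Euler characteristic zero. Hence
  \<open>W = \<integral> |H|\<^sup>2 dA\<close>, and \<open>W > 0\<close> unless the torus is minimal. It cannot be minimal: the function
  \<open>|pr\<^sub>1 \<circ> x|\<^sup>2\<close>, with \<open>pr\<^sub>1\<close> the projection to the plane, would have positive Laplacian everywhere,
  but it has a maximum. For the product tori the circles of radius \<open>t\<close> have curvature \<open>1/t\<close> and the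
  other factor is geodesic, so \<open>|H|\<^sup>2 = 1/(4 t\<^sup>2)\<close> on an area of \<open>4 \<pi>\<^sup>2 t\<close>. The infimum \<open>0\<close> is therefore
  approached and never attained.

  Two ingredients are proved here for any immersion of the coordinate plane into a
  Euclidean space. The lemma \<open>gauss_equation\<close> expresses the curvature tensor of the induced metric,
  which is defined intrinsically, by second derivatives of the immersion: the Christoffel symbols
  are the tangential parts of those derivatives (\<open>christoffel_eq\<close>). The lemma \<open>liouville_formula\<close>
  then writes \<open>K dA\<close> as the exterior derivative of the connection form of the orthonormal frame that
  starts with the direction of the first coordinate. That frame is global on a torus, so
  the form is doubly periodic and the Gauss-Bonnet theorem reduces to the fundamental theorem of
  calculus (\<open>gauss_bonnet_torus\<close>).

  The maximum argument is made pointwise in \<open>mean_curvature_nonzero_somewhere\<close>.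
\<close>

section \<open>Directional derivatives of smooth maps\<close>

text \<open>
  With the direction as first argument this is an operator on maps, so that higher derivatives are
  its iterates.
\<close>

definition along ::
    "'a::real_normed_vector \<Rightarrow> ('a \<Rightarrow> 'b::real_normed_vector) \<Rightarrow> 'a \<Rightarrow> 'b"  ("\<partial>")
  where "\<partial> X f p = frechet_derivative f (at p) X"

lemma frechet_derivative_eq_along: "frechet_derivative f (at p) X = \<partial> X f p"
  by (simp add: along_def)

lemma along_eqI: "(f has_derivative f') (at p) \<Longrightarrow> \<partial> X f p = f' X"
  by (metis along_def frechet_derivative_at)

lemma smooth_differentiable: "smooth f \<Longrightarrow> f differentiable (at p)"
  unfolding smooth_def by (metis C_k.simps(2))

lemma smooth_along: "smooth f \<Longrightarrow> smooth (\<partial> X f)"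
  unfolding smooth_def along_def by (metis C_k.simps(2))

lemma smooth_continuous: "smooth f \<Longrightarrow> continuous_on A f"
  unfolding smooth_def by (metis C_k.simps(1) continuous_on_subset subset_UNIV)

lemma smooth_has_derivative:
  assumes "smooth f"
  shows "(f has_derivative (\<lambda>X. \<partial> X f p)) (at p)"
  using smooth_differentiable[OF assms, of p]
  unfolding along_def frechet_derivative_works .

lemma linear_along: "smooth f \<Longrightarrow> linear (\<lambda>X. \<partial> X f p)"
  by (rule bounded_linear.linear[OF has_derivative_bounded_linear[OF smooth_has_derivative]])

lemma smooth_vector_derivative_line:
  fixes f :: "'a::euclidean_space \<Rightarrow> 'b::euclidean_space"
  assumes "smooth f"
  shows "((\<lambda>s. f (p + s *\<^sub>R X)) has_vector_derivative \<partial> X f (p + s *\<^sub>R X)) (at s)"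
proof -
  have "((\<lambda>s. p + s *\<^sub>R X) has_derivative (\<lambda>d. d *\<^sub>R X)) (at s)"
    by (auto intro!: derivative_eq_intros)
  from has_derivative_compose[OF this smooth_has_derivative[OF assms]]
  show ?thesis
    by (simp only: has_vector_derivative_def linear_scale[OF linear_along[OF assms]])
qed

lemma smooth_DERIV_line:
  fixes f :: "'a::euclidean_space \<Rightarrow> 'b::euclidean_space"
  assumes "smooth f"
  shows "((\<lambda>s. f (p + s *\<^sub>R X) \<bullet> c) has_real_derivative \<partial> X f (p + s *\<^sub>R X) \<bullet> c) (at s)"
  unfolding has_real_derivative_iff_has_vector_derivative
  by (rule bounded_linear.has_vector_derivative[OF bounded_linear_inner_left
        smooth_vector_derivative_line[OF assms]])

lemma second_difference_mean_value:
  fixes f :: "'a::euclidean_space \<Rightarrow> 'b::euclidean_space"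
  assumes f: "smooth f" and h: "0 < h"
  shows "\<exists>s t. 0 < s \<and> s < h \<and> 0 < t \<and> t < h \<and>
    (f (p + h *\<^sub>R X + h *\<^sub>R Y) - f (p + h *\<^sub>R X) - f (p + h *\<^sub>R Y) + f p) \<bullet> c
      = h\<^sup>2 * (\<partial> Y (\<partial> X f) (p + s *\<^sub>R X + t *\<^sub>R Y) \<bullet> c)"
proof -
  let ?\<phi> = "\<lambda>s. f ((p + h *\<^sub>R Y) + s *\<^sub>R X) \<bullet> c - f (p + s *\<^sub>R X) \<bullet> c"
  have "\<exists>s>0. s < h \<and> ?\<phi> h - ?\<phi> 0
      = (h - 0) * (\<partial> X f ((p + h *\<^sub>R Y) + s *\<^sub>R X) \<bullet> c - \<partial> X f (p + s *\<^sub>R X) \<bullet> c)"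
    using h by (intro MVT2 DERIV_diff smooth_DERIV_line[OF f]) auto
  then obtain s where s: "0 < s" "s < h" "?\<phi> h - ?\<phi> 0
      = h * (\<partial> X f ((p + h *\<^sub>R Y) + s *\<^sub>R X) \<bullet> c - \<partial> X f (p + s *\<^sub>R X) \<bullet> c)" by auto
  let ?\<chi> = "\<lambda>t. \<partial> X f ((p + s *\<^sub>R X) + t *\<^sub>R Y) \<bullet> c"
  have "\<exists>t>0. t < h \<and> ?\<chi> h - ?\<chi> 0 = (h - 0) * (\<partial> Y (\<partial> X f) ((p + s *\<^sub>R X) + t *\<^sub>R Y) \<bullet> c)"
    using h by (intro MVT2 smooth_DERIV_line[OF smooth_along[OF f]]) auto
  then obtain t where t: "0 < t" "t < h"
    "?\<chi> h - ?\<chi> 0 = h * (\<partial> Y (\<partial> X f) ((p + s *\<^sub>R X) + t *\<^sub>R Y) \<bullet> c)" by auto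
  have "?\<phi> h - ?\<phi> 0 = h * (?\<chi> h - ?\<chi> 0)"
    using s(3) by (simp add: algebra_simps)
  then have "(f (p + h *\<^sub>R X + h *\<^sub>R Y) - f (p + h *\<^sub>R X) - f (p + h *\<^sub>R Y) + f p) \<bullet> c
      = h\<^sup>2 * (\<partial> Y (\<partial> X f) (p + s *\<^sub>R X + t *\<^sub>R Y) \<bullet> c)"
    unfolding t(3) by (simp add: algebra_simps power2_eq_square)
  with s t show ?thesis by blast
qed

text \<open>
  Symmetry of second derivatives. The second difference of \<open>f\<close> over a small parallelogram is
  symmetric in its two sides, and the mean value theorem identifies it, up to the factor \<open>h\<^sup>2\<close>,
  with either mixed derivative at a nearby point.
\<close>

lemma along_commute:
  fixes f :: "'a::euclidean_space \<Rightarrow> 'b::euclidean_space"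
  assumes f: "smooth f"
  shows "\<partial> X (\<partial> Y f) p = \<partial> Y (\<partial> X f) p"
proof -
  define h where "h n = 1 / real (Suc n)" for n
  have h: "h n > 0" for n by (simp add: h_def)
  have h0: "h \<longlonglongrightarrow> 0" unfolding h_def by (rule LIMSEQ_Suc[OF lim_1_over_n])
  have "\<partial> X (\<partial> Y f) p \<bullet> c = \<partial> Y (\<partial> X f) p \<bullet> c" for c
  proof -
    obtain s t where st: "\<And>n. 0 < s n" "\<And>n. s n < h n" "\<And>n. 0 < t n" "\<And>n. t n < h n"
      and A: "\<And>n. (f (p + h n *\<^sub>R X + h n *\<^sub>R Y) - f (p + h n *\<^sub>R X) - f (p + h n *\<^sub>R Y) + f p) \<bullet> c
      = (h n)\<^sup>2 * (\<partial> Y (\<partial> X f) (p + s n *\<^sub>R X + t n *\<^sub>R Y) \<bullet> c)"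
      using second_difference_mean_value[OF f h, of _ p X Y c] by metis
    obtain s' t' where st': "\<And>n. 0 < s' n" "\<And>n. s' n < h n" "\<And>n. 0 < t' n" "\<And>n. t' n < h n"
      and B: "\<And>n. (f (p + h n *\<^sub>R Y + h n *\<^sub>R X) - f (p + h n *\<^sub>R Y) - f (p + h n *\<^sub>R X) + f p) \<bullet> c
      = (h n)\<^sup>2 * (\<partial> X (\<partial> Y f) (p + s' n *\<^sub>R Y + t' n *\<^sub>R X) \<bullet> c)"
      using second_difference_mean_value[OF f h, of _ p Y X c] by metis
    have lim: "r \<longlonglongrightarrow> 0" if "\<And>n. 0 < r n" "\<And>n. r n < h n" for r
      by (rule tendsto_sandwich[OF _ _ tendsto_const h0])
        (use that in \<open>auto intro!: always_eventually less_imp_le\<close>)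
    have "\<partial> Y (\<partial> X f) (p + s n *\<^sub>R X + t n *\<^sub>R Y) \<bullet> c
        = \<partial> X (\<partial> Y f) (p + s' n *\<^sub>R Y + t' n *\<^sub>R X) \<bullet> c" for n
    proof -
      have "(h n)\<^sup>2 * (\<partial> Y (\<partial> X f) (p + s n *\<^sub>R X + t n *\<^sub>R Y) \<bullet> c)
          = (h n)\<^sup>2 * (\<partial> X (\<partial> Y f) (p + s' n *\<^sub>R Y + t' n *\<^sub>R X) \<bullet> c)"
        unfolding A[symmetric] B[symmetric] by (simp add: algebra_simps)
      then show ?thesis using h[of n] by simp
    qed
    moreover have "(\<lambda>n. \<partial> Y (\<partial> X f) (p + s n *\<^sub>R X + t n *\<^sub>R Y) \<bullet> c) \<longlonglongrightarrow> \<partial> Y (\<partial> X f) p \<bullet> c"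
    proof -
      have "(\<lambda>n. p + s n *\<^sub>R X + t n *\<^sub>R Y) \<longlonglongrightarrow> p + 0 *\<^sub>R X + 0 *\<^sub>R Y"
        by (intro tendsto_intros lim st)
      moreover have "isCont (\<partial> Y (\<partial> X f)) p"
        using smooth_continuous[OF smooth_along[OF smooth_along[OF f]], of UNIV]
        by (simp add: continuous_on_eq_continuous_at)
      ultimately show ?thesis
        by (intro tendsto_inner tendsto_const) (auto intro: isCont_tendsto_compose)
    qed
    moreover have "(\<lambda>n. \<partial> X (\<partial> Y f) (p + s' n *\<^sub>R Y + t' n *\<^sub>R X) \<bullet> c) \<longlonglongrightarrow> \<partial> X (\<partial> Y f) p \<bullet> c"
    proof -
      have "(\<lambda>n. p + s' n *\<^sub>R Y + t' n *\<^sub>R X) \<longlonglongrightarrow> p + 0 *\<^sub>R Y + 0 *\<^sub>R X"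
        by (intro tendsto_intros lim st')
      moreover have "isCont (\<partial> X (\<partial> Y f)) p"
        using smooth_continuous[OF smooth_along[OF smooth_along[OF f]], of UNIV]
        by (simp add: continuous_on_eq_continuous_at)
      ultimately show ?thesis
        by (intro tendsto_inner tendsto_const) (auto intro: isCont_tendsto_compose)
    qed
    ultimately show ?thesis using LIMSEQ_unique by (metis (no_types, lifting) ext)
  qed
  then show ?thesis by (rule euclidean_eqI)
qed

lemma along_plane:
  fixes f :: "real \<times> real \<Rightarrow> 'b::euclidean_space"
  assumes "smooth f"
  shows "\<partial> X f p = fst X *\<^sub>R \<partial> (1, 0) f p + snd X *\<^sub>R \<partial> (0, 1) f p"
proof -
  have "X = fst X *\<^sub>R (1, 0) + snd X *\<^sub>R (0, 1)" by (cases X) simp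
  then have "\<partial> X f p = \<partial> (fst X *\<^sub>R (1, 0) + snd X *\<^sub>R (0, 1)) f p" by metis
  then show ?thesis
    by (simp only: linear_add[OF linear_along[OF assms]] linear_scale[OF linear_along[OF assms]])
qed

lemma along_along_plane:
  fixes f :: "real \<times> real \<Rightarrow> 'b::euclidean_space"
  assumes "smooth f"
  shows "\<partial> X (\<partial> Y f) p = fst X *\<^sub>R fst Y *\<^sub>R \<partial> (1, 0) (\<partial> (1, 0) f) p
    + (fst X * snd Y + snd X * fst Y) *\<^sub>R \<partial> (1, 0) (\<partial> (0, 1) f) p
    + snd X *\<^sub>R snd Y *\<^sub>R \<partial> (0, 1) (\<partial> (0, 1) f) p"
proof -
  have Y: "\<partial> e (\<partial> Y f) p = fst Y *\<^sub>R \<partial> e (\<partial> (1, 0) f) p + snd Y *\<^sub>R \<partial> e (\<partial> (0, 1) f) p" for e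
    using along_plane[OF smooth_along[OF assms, of e], of Y p]
    by (simp only: along_commute[OF assms, of e])
  show ?thesis
    unfolding Y along_plane[OF smooth_along[OF assms], of X]
    by (simp add: along_commute[OF assms, of "(0,1)" "(1,0)"] algebra_simps)
qed

section \<open>The Gauss equation for an immersed coordinate plane\<close>

text \<open>
  Cramer's rule for a symmetric bilinear form with Gram matrix \<open>E, F, G\<close>.
\<close>

lemma sharp_plane:
  fixes b :: "real \<times> real \<Rightarrow> real \<times> real \<Rightarrow> real"
  assumes b: "\<And>V W. b V W = E * fst V * fst W + F * (fst V * snd W + snd V * fst W) + G * snd V * snd W"
    and det: "E * G - F\<^sup>2 \<noteq> 0"
    and \<alpha>: "\<And>Z. \<alpha> Z = fst Z * \<alpha> (1, 0) + snd Z * \<alpha> (0, 1)"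
  shows "sharp b \<alpha> = ((G * \<alpha> (1, 0) - F * \<alpha> (0, 1)) / (E * G - F\<^sup>2),
    (E * \<alpha> (0, 1) - F * \<alpha> (1, 0)) / (E * G - F\<^sup>2))" (is "_ = ?w")
  unfolding sharp_def
proof (rule the_equality)
  have "E * fst ?w + F * snd ?w = \<alpha> (1, 0)" "F * fst ?w + G * snd ?w = \<alpha> (0, 1)"
    using det by (simp_all add: divide_simps) (simp_all add: power2_eq_square algebra_simps)
  moreover have "b ?w Z = fst Z * (E * fst ?w + F * snd ?w) + snd Z * (F * fst ?w + G * snd ?w)" for Z
    unfolding b by (simp only: algebra_simps)
  ultimately show "\<forall>Z. b ?w Z = \<alpha> Z" by (metis \<alpha>)
next
  fix w assume w: "\<forall>Z. b w Z = \<alpha> Z"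
  have 1: "E * fst w + F * snd w = \<alpha> (1, 0)" and 2: "F * fst w + G * snd w = \<alpha> (0, 1)"
    using w[rule_format, of "(1, 0)"] w[rule_format, of "(0, 1)"] by (simp_all add: b)
  show "w = ?w"
    unfolding 1[symmetric] 2[symmetric] using det
    by (intro prod_eqI) (simp_all add: eq_divide_eq power2_eq_square algebra_simps)
qed

text \<open>
  The algebra behind Liouville's formula for the Gauss curvature, with \<open>s\<close> the area density. The
  numbers \<open>a\<^sub>i, b\<^sub>i, c\<^sub>i\<close> are the inner products of \<open>f\<^sub>1\<^sub>1, f\<^sub>1\<^sub>2, f\<^sub>2\<^sub>2\<close> with \<open>f\<^sub>i\<close>, \<open>t\<^sub>i\<close> is that of the
  third derivative \<open>f\<^sub>1\<^sub>1\<^sub>2\<close>, and \<open>m, n, k\<close> are those of \<open>f\<^sub>1\<^sub>1\<close> with \<open>f\<^sub>2\<^sub>2\<close>, of \<open>f\<^sub>1\<^sub>2\<close> with itself, and of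
  \<open>f\<^sub>1\<^sub>1\<close> with \<open>f\<^sub>1\<^sub>2\<close>. The left-hand side is a difference of two derivatives of quotients with
  denominator \<open>E s\<close>; the third derivatives cancel because partial derivatives commute.
\<close>

lemma liouville_identity:
  fixes E F G s a\<^sub>1 a\<^sub>2 b\<^sub>1 b\<^sub>2 c\<^sub>1 c\<^sub>2 t\<^sub>1 t\<^sub>2 m n k :: real
  assumes s: "s\<^sup>2 = E * G - F\<^sup>2" and nz: "E \<noteq> 0" "s \<noteq> 0"
  shows "((2 * b\<^sub>1 * a\<^sub>2 + E * (t\<^sub>2 + m) - (b\<^sub>2 + c\<^sub>1) * a\<^sub>1 - F * (t\<^sub>1 + k)) * (E * s)
      - (E * a\<^sub>2 - F * a\<^sub>1) * (2 * b\<^sub>1 * s + E * (2 * b\<^sub>1 * G + E * (2 * c\<^sub>2) - 2 * F * (b\<^sub>2 + c\<^sub>1)) / (2 * s))) / (E * s)\<^sup>2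
    - ((2 * a\<^sub>1 * b\<^sub>2 + E * (t\<^sub>2 + n) - (a\<^sub>2 + b\<^sub>1) * b\<^sub>1 - F * (t\<^sub>1 + k)) * (E * s)
      - (E * b\<^sub>2 - F * b\<^sub>1) * (2 * a\<^sub>1 * s + E * (2 * a\<^sub>1 * G + E * (2 * b\<^sub>2) - 2 * F * (a\<^sub>2 + b\<^sub>1)) / (2 * s))) / (E * s)\<^sup>2
    = (m - n - (G * a\<^sub>1 * c\<^sub>1 - F * a\<^sub>1 * c\<^sub>2 - F * a\<^sub>2 * c\<^sub>1 + E * a\<^sub>2 * c\<^sub>2
      - (G * b\<^sub>1\<^sup>2 - 2 * F * b\<^sub>1 * b\<^sub>2 + E * b\<^sub>2\<^sup>2)) / s\<^sup>2) / s"
proof -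
  have G: "G = (s\<^sup>2 + F\<^sup>2) / E" using s nz by (simp add: field_simps)
  show ?thesis unfolding G using nz
    by (simp add: divide_simps) (simp add: power2_eq_square algebra_simps)
qed
locale immersed_plane =
  fixes f :: "real \<times> real \<Rightarrow> 'b::euclidean_space"
  assumes smooth: "smooth f" and immersion: "\<And>p. inj (frechet_derivative f (at p))"
begin

abbreviation "f\<^sub>1 \<equiv> \<partial> (1, 0) f"
abbreviation "f\<^sub>2 \<equiv> \<partial> (0, 1) f"
abbreviation "f\<^sub>1\<^sub>1 \<equiv> \<partial> (1, 0) f\<^sub>1"
abbreviation "f\<^sub>1\<^sub>2 \<equiv> \<partial> (1, 0) f\<^sub>2"
abbreviation "f\<^sub>2\<^sub>2 \<equiv> \<partial> (0, 1) f\<^sub>2"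

definition "E q = f\<^sub>1 q \<bullet> f\<^sub>1 q"
definition "F q = f\<^sub>1 q \<bullet> f\<^sub>2 q"
definition "G q = f\<^sub>2 q \<bullet> f\<^sub>2 q"
definition "\<delta> q = E q * G q - (F q)\<^sup>2"

text \<open>
  The coordinates, in the basis \<open>f\<^sub>1, f\<^sub>2\<close> of the tangent plane, of the orthogonal projection of \<open>w\<close>.
\<close>

definition tangential :: "real \<times> real \<Rightarrow> 'b \<Rightarrow> real \<times> real"
  where "tangential q w = ((G q * (w \<bullet> f\<^sub>1 q) - F q * (w \<bullet> f\<^sub>2 q)) / \<delta> q,
    (E q * (w \<bullet> f\<^sub>2 q) - F q * (w \<bullet> f\<^sub>1 q)) / \<delta> q)"

definition normal_part :: "real \<times> real \<Rightarrow> 'b \<Rightarrow> 'b"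
  where "normal_part q w = w - \<partial> (tangential q w) f q"

lemmas smooths = smooth smooth_along[OF smooth] smooth_along[OF smooth_along[OF smooth]]

lemma along_f: "\<partial> X f q = fst X *\<^sub>R f\<^sub>1 q + snd X *\<^sub>R f\<^sub>2 q"
  by (rule along_plane[OF smooth])

lemma inner_along: "w \<bullet> \<partial> X f q = fst X * (w \<bullet> f\<^sub>1 q) + snd X * (w \<bullet> f\<^sub>2 q)"
  unfolding along_f[of X] by (simp add: inner_add_right)

lemma along_eq_0_iff: "\<partial> X f q = 0 \<longleftrightarrow> X = 0"
  using immersion[of q] linear_0[OF linear_along[OF smooth, of q]]
  unfolding along_def inj_def by metis

lemma E_pos: "E q > 0"
  unfolding E_def by (simp add: along_eq_0_iff zero_prod_def)

text \<open>
  The vector \<open>E f\<^sub>2 - F f\<^sub>1\<close> is orthogonal to \<open>f\<^sub>1\<close> and has squared length \<open>E \<delta>\<close>.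
\<close>

lemma \<delta>_pos: "\<delta> q > 0"
proof -
  have "E q * \<delta> q = \<partial> (- F q, E q) f q \<bullet> \<partial> (- F q, E q) f q"
    unfolding along_f[of "(- F q, E q)"] \<delta>_def
    by (simp add: inner_simps E_def F_def G_def inner_commute power2_eq_square algebra_simps)
  also have "\<dots> > 0"
    using E_pos[of q] by (simp add: along_eq_0_iff zero_prod_def del: inner_Pair)
  finally show ?thesis using E_pos[of q] by (simp add: zero_less_mult_iff)
qed

lemma \<delta>_nz [simp]: "\<delta> q \<noteq> 0"
  using \<delta>_pos[of q] by simp

lemma metric_quadratic: "induced_metric f q V W =
    E q * fst V * fst W + F q * (fst V * snd W + snd V * fst W) + G q * snd V * snd W"
  unfolding induced_metric_def frechet_derivative_eq_along along_f[of V] along_f[of W]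
  by (simp add: inner_simps E_def F_def G_def inner_commute algebra_simps)

lemma sharp_metric:
  assumes "\<And>Z. \<alpha> Z = fst Z * \<alpha> (1, 0) + snd Z * \<alpha> (0, 1)"
  shows "sharp (induced_metric f q) \<alpha> = ((G q * \<alpha> (1, 0) - F q * \<alpha> (0, 1)) / \<delta> q,
    (E q * \<alpha> (0, 1) - F q * \<alpha> (1, 0)) / \<delta> q)"
  unfolding \<delta>_def by (rule sharp_plane[OF metric_quadratic])
    (fact \<delta>_nz[of q, unfolded \<delta>_def], rule assms)

lemma tangential_inner: "\<partial> (tangential q w) f q \<bullet> \<partial> X f q = w \<bullet> \<partial> X f q"
proof -
  have *: "\<partial> (tangential q w) f q \<bullet> v = fst (tangential q w) * (v \<bullet> f\<^sub>1 q)
      + snd (tangential q w) * (v \<bullet> f\<^sub>2 q)" for v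
    by (subst inner_commute) (rule inner_along)
  have "\<partial> (tangential q w) f q \<bullet> f\<^sub>1 q = w \<bullet> f\<^sub>1 q"
    unfolding *
    unfolding E_def[symmetric] F_def[symmetric] tangential_def
    by (simp add: field_simps) (simp add: \<delta>_def power2_eq_square algebra_simps)
  moreover have "\<partial> (tangential q w) f q \<bullet> f\<^sub>2 q = w \<bullet> f\<^sub>2 q"
    unfolding *
    unfolding G_def[symmetric] inner_commute[of "f\<^sub>2 q" "f\<^sub>1 q"]
    unfolding F_def[symmetric] tangential_def
    by (simp add: field_simps) (simp add: \<delta>_def power2_eq_square algebra_simps)
  ultimately show ?thesis by (simp add: inner_along[of _ X])
qed

lemma linear_normal_part: "linear (normal_part q)"
proof -
  have "linear (tangential q)"
    by (rule linearI) (simp_all add: tangential_def inner_simps algebra_simps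
        add_divide_distrib diff_divide_distrib)
  from linear_compose[OF this linear_along[OF smooth, of q]] show ?thesis
    unfolding normal_part_def[abs_def] by (intro linear_compose_sub linear_ident) (simp add: o_def)
qed

lemma normal_part_orthogonal: "normal_part q w \<bullet> \<partial> X f q = 0"
  by (simp add: normal_part_def inner_diff_left tangential_inner)

lemma normal_part_inner: "normal_part q w \<bullet> w' = w \<bullet> w' -
    (G q * (w \<bullet> f\<^sub>1 q) * (w' \<bullet> f\<^sub>1 q) - F q * (w \<bullet> f\<^sub>1 q) * (w' \<bullet> f\<^sub>2 q)
     - F q * (w \<bullet> f\<^sub>2 q) * (w' \<bullet> f\<^sub>1 q) + E q * (w \<bullet> f\<^sub>2 q) * (w' \<bullet> f\<^sub>2 q)) / \<delta> q"
  unfolding normal_part_def inner_diff_left inner_commute[of "\<partial> (tangential q w) f q"]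
  unfolding inner_along[of _ "tangential q w"]
  by (simp add: tangential_def field_simps)

lemma has_derivative_inner_along [derivative_intros]:
  assumes "smooth a" "smooth b"
  shows "((\<lambda>q. a q \<bullet> (b q :: 'b)) has_derivative (\<lambda>X. a p \<bullet> \<partial> X b p + \<partial> X a p \<bullet> b p)) (at p)"
  by (intro has_derivative_inner smooth_has_derivative assms)

lemma along_inner: "smooth a \<Longrightarrow> smooth b \<Longrightarrow>
    \<partial> X (\<lambda>q. a q \<bullet> (b q :: 'b)) p = \<partial> X a p \<bullet> b p + a p \<bullet> \<partial> X b p"
  by (subst along_eqI[OF has_derivative_inner_along]) simp_all

text \<open>
  The Koszul formula, evaluated on \<open>\<langle>f\<^sub>Y, f\<^sub>Z\<rangle>\<close>, collapses to \<open>\<langle>f\<^sub>X\<^sub>Y, f\<^sub>Z\<rangle>\<close>: the Levi-Civita connection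
  of an induced metric is the tangential part of the flat derivative.
\<close>

lemma christoffel_eq: "christoffel (induced_metric f) q X Y = tangential q (\<partial> X (\<partial> Y f) q)"
proof -
  have "(\<partial> X (\<lambda>r. \<partial> Y f r \<bullet> \<partial> Z f r) q + \<partial> Y (\<lambda>r. \<partial> X f r \<bullet> \<partial> Z f r) q
      - \<partial> Z (\<lambda>r. \<partial> X f r \<bullet> \<partial> Y f r) q) / 2 = \<partial> X (\<partial> Y f) q \<bullet> \<partial> Z f q" for Z
    unfolding along_inner[OF smooths(2) smooths(2)] along_commute[OF smooth, of Y X]
      along_commute[OF smooth, of Z]
    by (simp add: inner_commute)
  then have "christoffel (induced_metric f) q X Y =
      sharp (induced_metric f q) (\<lambda>Z. \<partial> X (\<partial> Y f) q \<bullet> \<partial> Z f q)"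
    unfolding christoffel_def
    by (simp add: induced_metric_def[abs_def] frechet_derivative_eq_along)
  also have "\<dots> = tangential q (\<partial> X (\<partial> Y f) q)"
    unfolding tangential_def by (rule sharp_metric) (rule inner_along)
  finally show ?thesis .
qed

lemma tangential_differentiable:
  assumes "smooth w"
  shows "(\<lambda>q. tangential q (w q)) differentiable (at p)"
proof -
  have d: "(\<lambda>q. a q \<bullet> (b q :: 'b)) differentiable (at p)" if "smooth a" "smooth b" for a b
    using has_derivative_inner_along[OF that] unfolding differentiable_def by blast
  have EFG: "E differentiable (at p)" "F differentiable (at p)" "G differentiable (at p)"
    unfolding E_def[abs_def] F_def[abs_def] G_def[abs_def] by (intro d smooths)+
  have w: "(\<lambda>q. w q \<bullet> f\<^sub>1 q) differentiable (at p)" "(\<lambda>q. w q \<bullet> f\<^sub>2 q) differentiable (at p)"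
    by (intro d smooths assms)+
  have "\<delta> differentiable (at p)"
    unfolding \<delta>_def[abs_def] power2_eq_square
    by (intro differentiable_diff differentiable_mult EFG)
  then have "(\<lambda>q. (G q * (w q \<bullet> f\<^sub>1 q) - F q * (w q \<bullet> f\<^sub>2 q)) / \<delta> q) differentiable (at p)"
    "(\<lambda>q. (E q * (w q \<bullet> f\<^sub>2 q) - F q * (w q \<bullet> f\<^sub>1 q)) / \<delta> q) differentiable (at p)"
    by (intro differentiable_divide differentiable_diff differentiable_mult EFG w \<delta>_nz; simp)+
  then show ?thesis
    unfolding tangential_def differentiable_def
    by (elim exE) (rule exI, rule has_derivative_Pair)
qed

text \<open>
  The field \<open>V = \<nabla>\<^sub>Y Z\<close> satisfies \<open>\<langle>df V, f\<^sub>W\<rangle> = \<langle>f\<^sub>Y\<^sub>Z, f\<^sub>W\<rangle>\<close> at every point. Differentiating this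
  identity in the direction \<open>X\<close> gives \<open>\<nabla>\<^sub>X V\<close> without a formula for the derivatives of the Christoffel
  symbols, and the two terms with \<open>f\<^sub>X\<^sub>W\<close> combine to the normal part of \<open>f\<^sub>Y\<^sub>Z\<close>.
\<close>

lemma second_cov_deriv_inner:
  "induced_metric f p (cov_deriv (induced_metric f) X (cov_deriv (induced_metric f) Y (\<lambda>_. Z)) p) W
    = \<partial> X (\<partial> Y (\<partial> Z f)) p \<bullet> \<partial> W f p + normal_part p (\<partial> Y (\<partial> Z f) p) \<bullet> \<partial> X (\<partial> W f) p"
proof -
  define V where "V q = tangential q (\<partial> Y (\<partial> Z f) q)" for q
  have V: "(V has_derivative (\<lambda>X. \<partial> X V p)) (at p)"
    using tangential_differentiable[OF smooths(3)[of Y Z]]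
    unfolding V_def[abs_def] along_def frechet_derivative_works .
  have cov: "cov_deriv (induced_metric f) Y (\<lambda>_. Z) = V"
    by (rule ext) (simp add: cov_deriv_def christoffel_eq V_def)
  have "((\<lambda>q. \<partial> (V q) f q \<bullet> \<partial> W f q) has_derivative
      (\<lambda>X. \<partial> (V p) f p \<bullet> \<partial> X (\<partial> W f) p
        + (fst (\<partial> X V p) *\<^sub>R f\<^sub>1 p + fst (V p) *\<^sub>R \<partial> X f\<^sub>1 p
          + (snd (\<partial> X V p) *\<^sub>R f\<^sub>2 p + snd (V p) *\<^sub>R \<partial> X f\<^sub>2 p)) \<bullet> \<partial> W f p)) (at p)"
    unfolding along_f[of "V q" for q]
    by (rule derivative_eq_intros has_derivative_fst[OF V] has_derivative_snd[OF V]
        smooth_has_derivative smooths refl)+ (simp add: algebra_simps fun_eq_iff)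
  moreover have "(\<lambda>q. \<partial> (V q) f q \<bullet> \<partial> W f q) = (\<lambda>q. \<partial> Y (\<partial> Z f) q \<bullet> \<partial> W f q)"
    by (simp add: V_def tangential_inner)
  ultimately have "\<partial> (V p) f p \<bullet> \<partial> X (\<partial> W f) p
        + (fst (\<partial> X V p) *\<^sub>R f\<^sub>1 p + fst (V p) *\<^sub>R \<partial> X f\<^sub>1 p
          + (snd (\<partial> X V p) *\<^sub>R f\<^sub>2 p + snd (V p) *\<^sub>R \<partial> X f\<^sub>2 p)) \<bullet> \<partial> W f p
      = \<partial> X (\<partial> Y (\<partial> Z f)) p \<bullet> \<partial> W f p + \<partial> Y (\<partial> Z f) p \<bullet> \<partial> X (\<partial> W f) p"
    using along_inner[OF smooths(3) smooths(2), of X Y Z W p]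
    by (simp add: along_eqI[of "\<lambda>q. \<partial> Y (\<partial> Z f) q \<bullet> \<partial> W f q"])
  moreover have "\<partial> X (\<partial> (V p) f) p = fst (V p) *\<^sub>R \<partial> X f\<^sub>1 p + snd (V p) *\<^sub>R \<partial> X f\<^sub>2 p"
    using along_plane[OF smooths(2), of "V p" X p]
    by (simp add: along_commute[OF smooth, of X])
  ultimately show ?thesis
    unfolding cov cov_deriv_def[of _ X V] christoffel_eq
    unfolding induced_metric_def frechet_derivative_eq_along linear_add[OF linear_along[OF smooth]]
      inner_add_left tangential_inner
    by (simp add: along_f[of "\<partial> X V p"] normal_part_def V_def[symmetric] inner_simps)
qed

text \<open>
  Antisymmetrising \<open>second_cov_deriv_inner\<close> in \<open>X\<close> and \<open>Y\<close> removes the third derivatives. Since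
  normal parts are orthogonal to the tangent plane, the right-hand side is the usual expression in
  the second fundamental form of the surface in Euclidean space.
\<close>

theorem gauss_equation:
  "induced_metric f p (riemann (induced_metric f) p X Y Z) W =
    normal_part p (\<partial> Y (\<partial> Z f) p) \<bullet> \<partial> X (\<partial> W f) p
      - normal_part p (\<partial> X (\<partial> Z f) p) \<bullet> \<partial> Y (\<partial> W f) p"
proof -
  have diff: "induced_metric f p (A - B) W = induced_metric f p A W - induced_metric f p B W" for A B
    unfolding metric_quadratic by (simp add: algebra_simps)
  have third: "\<partial> X (\<partial> Y (\<partial> Z f)) p = \<partial> Y (\<partial> X (\<partial> Z f)) p"
    by (rule along_commute[OF smooths(2)])
  show ?thesis
    unfolding riemann_def diff second_cov_deriv_inner third by (rule add_diff_cancel_left)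
qed

lemma gram_det_eq: "gram_det (induced_metric f p) (1, 0) (0, 1) = \<delta> p"
  by (simp add: gram_det_def metric_quadratic \<delta>_def)

text \<open>
  The Gauss equation with the normal parts written out, in the shape of the right-hand side of
  \<open>liouville_identity\<close>.
\<close>

lemma curvature_eq:
  "sectional_curvature (induced_metric f) p (1, 0) (0, 1) * sqrt (\<delta> p) =
    (f\<^sub>1\<^sub>1 p \<bullet> f\<^sub>2\<^sub>2 p - f\<^sub>1\<^sub>2 p \<bullet> f\<^sub>1\<^sub>2 p
      - (G p * (f\<^sub>1\<^sub>1 p \<bullet> f\<^sub>1 p) * (f\<^sub>2\<^sub>2 p \<bullet> f\<^sub>1 p) - F p * (f\<^sub>1\<^sub>1 p \<bullet> f\<^sub>1 p) * (f\<^sub>2\<^sub>2 p \<bullet> f\<^sub>2 p)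
         - F p * (f\<^sub>1\<^sub>1 p \<bullet> f\<^sub>2 p) * (f\<^sub>2\<^sub>2 p \<bullet> f\<^sub>1 p) + E p * (f\<^sub>1\<^sub>1 p \<bullet> f\<^sub>2 p) * (f\<^sub>2\<^sub>2 p \<bullet> f\<^sub>2 p)
         - (G p * (f\<^sub>1\<^sub>2 p \<bullet> f\<^sub>1 p)\<^sup>2 - 2 * F p * (f\<^sub>1\<^sub>2 p \<bullet> f\<^sub>1 p) * (f\<^sub>1\<^sub>2 p \<bullet> f\<^sub>2 p) + E p * (f\<^sub>1\<^sub>2 p \<bullet> f\<^sub>2 p)\<^sup>2))
        / (sqrt (\<delta> p))\<^sup>2) / sqrt (\<delta> p)"
proof -
  have s: "(sqrt (\<delta> p))\<^sup>2 = \<delta> p" using \<delta>_pos[of p] by simp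
  have root: "K / \<delta> p * sqrt (\<delta> p) = K / sqrt (\<delta> p)" for K
    using \<delta>_pos[of p] by (simp add: field_simps)
  show ?thesis
    unfolding sectional_curvature_def gram_det_eq root gauss_equation s normal_part_inner
    unfolding along_commute[OF smooth, of "(0, 1)" "(1, 0)"]
    by (rule arg_cong[where f = "\<lambda>x. x / sqrt (\<delta> p)"])
      (simp add: inner_commute[of "f\<^sub>2\<^sub>2 p" "f\<^sub>1\<^sub>1 p"] power2_eq_square
        diff_divide_distrib add_divide_distrib algebra_simps)
qed

definition "dE X q = 2 * (\<partial> X f\<^sub>1 q \<bullet> f\<^sub>1 q)"
definition "dF X q = \<partial> X f\<^sub>1 q \<bullet> f\<^sub>2 q + f\<^sub>1 q \<bullet> \<partial> X f\<^sub>2 q"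
definition "dG X q = 2 * (\<partial> X f\<^sub>2 q \<bullet> f\<^sub>2 q)"

text \<open>
  Let \<open>a = f\<^sub>1 / |f\<^sub>1|\<close> and let \<open>b\<close> be the unit tangent vector orthogonal to it. The connection form
  \<open>\<langle>da, b\<rangle>\<close> of this frame has the components \<open>connection_coeff f\<^sub>1\<^sub>1\<close> and \<open>connection_coeff f\<^sub>1\<^sub>2\<close>, as
  \<open>b\<close> is the normalised vector \<open>E f\<^sub>2 - F f\<^sub>1\<close>.
\<close>

definition connection_coeff :: "(real \<times> real \<Rightarrow> 'b) \<Rightarrow> real \<times> real \<Rightarrow> real"
  where "connection_coeff w q =
    (E q * (w q \<bullet> f\<^sub>2 q) - F q * (w q \<bullet> f\<^sub>1 q)) / (E q * sqrt (\<delta> q))"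

definition connection_coeff_deriv ::
    "(real \<times> real \<Rightarrow> 'b) \<Rightarrow> real \<times> real \<Rightarrow> real \<times> real \<Rightarrow> real"
  where "connection_coeff_deriv w q X =
    ((dE X q * (w q \<bullet> f\<^sub>2 q) + E q * (\<partial> X w q \<bullet> f\<^sub>2 q + w q \<bullet> \<partial> X f\<^sub>2 q)
        - dF X q * (w q \<bullet> f\<^sub>1 q) - F q * (\<partial> X w q \<bullet> f\<^sub>1 q + w q \<bullet> \<partial> X f\<^sub>1 q)) * (E q * sqrt (\<delta> q))
      - (E q * (w q \<bullet> f\<^sub>2 q) - F q * (w q \<bullet> f\<^sub>1 q)) * (dE X q * sqrt (\<delta> q)
          + E q * (dE X q * G q + E q * dG X q - 2 * F q * dF X q) / (2 * sqrt (\<delta> q))))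
    / (E q * sqrt (\<delta> q))\<^sup>2"

lemma connection_coeff_has_derivative:
  assumes w: "smooth w"
  shows "(connection_coeff w has_derivative connection_coeff_deriv w q) (at q)"
proof -
  have E: "(E has_derivative (\<lambda>X. dE X q)) (at q)"
    unfolding E_def[abs_def] dE_def
    by (rule has_derivative_eq_rhs[OF has_derivative_inner_along[OF smooths(2) smooths(2)]])
      (simp add: inner_commute)
  have F: "(F has_derivative (\<lambda>X. dF X q)) (at q)"
    unfolding F_def[abs_def] dF_def
    by (rule has_derivative_eq_rhs[OF has_derivative_inner_along[OF smooths(2) smooths(2)]])
      (simp add: add.commute)
  have G: "(G has_derivative (\<lambda>X. dG X q)) (at q)"
    unfolding G_def[abs_def] dG_def
    by (rule has_derivative_eq_rhs[OF has_derivative_inner_along[OF smooths(2) smooths(2)]])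
      (simp add: inner_commute)
  have \<delta>: "(\<delta> has_derivative (\<lambda>X. dE X q * G q + E q * dG X q - 2 * F q * dF X q)) (at q)"
    unfolding \<delta>_def[abs_def] power2_eq_square
    by (rule has_derivative_eq_rhs[OF has_derivative_diff[OF
          has_derivative_mult[OF E G] has_derivative_mult[OF F F]]]) (simp add: algebra_simps)
  have "((\<lambda>r. sqrt (\<delta> r)) has_derivative
      (\<lambda>X. (dE X q * G q + E q * dG X q - 2 * F q * dF X q) / (2 * sqrt (\<delta> q)))) (at q)"
    by (rule has_derivative_eq_rhs[OF has_derivative_real_sqrt[OF \<delta>_pos \<delta>]])
      (simp add: divide_simps mult.commute)
  note D = has_derivative_mult[OF E this]
  note N = has_derivative_diff[OF
      has_derivative_mult[OF E has_derivative_inner_along[OF w smooths(2), of "(0, 1)"]]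
      has_derivative_mult[OF F has_derivative_inner_along[OF w smooths(2), of "(1, 0)"]]]
  have nz: "E q * sqrt (\<delta> q) \<noteq> 0" using E_pos[of q] \<delta>_pos[of q] by simp
  show ?thesis
    unfolding connection_coeff_def[abs_def]
    by (rule has_derivative_eq_rhs[OF has_derivative_divide'[OF N D nz]])
      (simp add: fun_eq_iff connection_coeff_deriv_def power2_eq_square algebra_simps)
qed

text \<open>
  The structure equation: up to sign, \<open>K dA\<close> is the exterior derivative of the connection form.
\<close>

lemma liouville_formula:
  "connection_coeff_deriv f\<^sub>1\<^sub>1 q (0, 1) - connection_coeff_deriv f\<^sub>1\<^sub>2 q (1, 0)
    = sectional_curvature (induced_metric f) q (1, 0) (0, 1) * sqrt (\<delta> q)"
proof -
  have s: "(sqrt (\<delta> q))\<^sup>2 = E q * G q - (F q)\<^sup>2" "sqrt (\<delta> q) \<noteq> 0"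
    using \<delta>_pos[of q] by (simp_all add: \<delta>_def)
  have third: "\<partial> (0, 1) f\<^sub>1\<^sub>1 q = \<partial> (1, 0) f\<^sub>1\<^sub>2 q"
    by (metis (no_types, lifting) along_commute[OF smooth] along_commute[OF smooths(2)] ext)
  have E: "E q \<noteq> 0" using E_pos[of q] by simp
  show ?thesis
    unfolding curvature_eq
    using liouville_identity[OF s(1) E s(2), of "f\<^sub>1\<^sub>2 q \<bullet> f\<^sub>1 q" "f\<^sub>1\<^sub>1 q \<bullet> f\<^sub>2 q" "\<partial> (1, 0) f\<^sub>1\<^sub>2 q \<bullet> f\<^sub>2 q"
      "f\<^sub>1\<^sub>1 q \<bullet> f\<^sub>2\<^sub>2 q" "f\<^sub>1\<^sub>2 q \<bullet> f\<^sub>2 q" "f\<^sub>2\<^sub>2 q \<bullet> f\<^sub>1 q" "f\<^sub>1\<^sub>1 q \<bullet> f\<^sub>1 q" "\<partial> (1, 0) f\<^sub>1\<^sub>2 q \<bullet> f\<^sub>1 q"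
      "f\<^sub>1\<^sub>1 q \<bullet> f\<^sub>1\<^sub>2 q" "f\<^sub>2\<^sub>2 q \<bullet> f\<^sub>2 q" "f\<^sub>1\<^sub>2 q \<bullet> f\<^sub>1\<^sub>2 q"]
    unfolding connection_coeff_deriv_def dE_def dF_def dG_def third
      along_commute[OF smooth, of "(0, 1)" "(1, 0)"]
    by (simp add: inner_commute mult.assoc)
qed

lemma continuous_EFG [continuous_intros]:
  "continuous_on A E" "continuous_on A F" "continuous_on A G" "continuous_on A \<delta>"
proof -
  show "continuous_on A E" "continuous_on A F" "continuous_on A G"
    unfolding E_def[abs_def] F_def[abs_def] G_def[abs_def]
    by (intro continuous_intros smooth_continuous smooths)+
  then show "continuous_on A \<delta>" unfolding \<delta>_def[abs_def] by (intro continuous_intros)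
qed

lemma continuous_connection_coeff_deriv:
  assumes w: "smooth w"
  shows "continuous_on A (\<lambda>q. connection_coeff_deriv w q X)"
  unfolding connection_coeff_deriv_def dE_def dF_def dG_def
  by (intro continuous_intros smooth_continuous smooths w smooth_along[OF w] ballI)
    (use E_pos \<delta>_pos in \<open>simp_all add: less_imp_neq[symmetric]\<close>)

lemma continuous_curvature:
  "continuous_on A (\<lambda>q. sectional_curvature (induced_metric f) q (1, 0) (0, 1) * sqrt (\<delta> q))"
  unfolding liouville_formula[symmetric]
  by (intro continuous_intros continuous_connection_coeff_deriv smooths)

end

lemma along_periodic:
  assumes f: "smooth f" and per: "\<And>q. f (q + a) = f q"
  shows "\<partial> X f (q + a) = \<partial> X f q"
proof -
  have "((\<lambda>r. r + a) has_derivative (\<lambda>X. X)) (at q)" by (auto intro!: derivative_eq_intros)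
  from has_derivative_compose[OF this smooth_has_derivative[OF f]]
  have "((\<lambda>r. f (r + a)) has_derivative (\<lambda>X. \<partial> X f (q + a))) (at q)" .
  then show ?thesis unfolding per by (rule along_eqI[symmetric])
qed

text \<open>
  Integrating first in the direction of the derivative gives the difference of the values of \<open>P\<close>
  at the two ends of a period.
\<close>

lemma integral_partial_periodic:
  fixes P :: "real \<times> real \<Rightarrow> real"
  assumes P: "\<And>q. (P has_derivative P' q) (at q)"
    and T: "0 \<le> T"
  shows "continuous_on UNIV (\<lambda>q. P' q (1, 0)) \<Longrightarrow> (\<And>u v. P (u + T, v) = P (u, v)) \<Longrightarrow>
      integral (cbox (0, 0) (T, T)) (\<lambda>q. P' q (1, 0)) = 0" (is "?c1 \<Longrightarrow> PROP _ \<Longrightarrow> ?i1")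
    and "continuous_on UNIV (\<lambda>q. P' q (0, 1)) \<Longrightarrow> (\<And>u v. P (u, v + T) = P (u, v)) \<Longrightarrow>
      integral (cbox (0, 0) (T, T)) (\<lambda>q. P' q (0, 1)) = 0" (is "?c2 \<Longrightarrow> PROP _ \<Longrightarrow> ?i2")
proof -
  have lin: "P' q (d *\<^sub>R X) = d *\<^sub>R P' q X" for q X d
    using has_derivative_linear[OF P[of q]] by (rule linear_scale)
  {
    assume c: ?c1 and per: "\<And>u v. P (u + T, v) = P (u, v)"
    have "integral {0..T} (\<lambda>u. P' (u, v) (1, 0)) = 0" for v
    proof -
      have "((\<lambda>u. P (u, v)) has_vector_derivative P' (u, v) (1, 0)) (at u within {0..T})" for u
      proof -
        have "((\<lambda>u. (u, v)) has_derivative (\<lambda>d. d *\<^sub>R (1, 0))) (at u within {0..T})"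
          by (auto intro!: derivative_eq_intros)
        from has_derivative_compose[OF this P] show ?thesis
          by (simp only: has_vector_derivative_def lin)
      qed
      from fundamental_theorem_of_calculus[OF T this]
      show ?thesis using per[of 0 v] by (simp add: integral_unique)
    qed
    moreover have "integral (cbox (0, 0) (T, T)) (\<lambda>(u, v). P' (u, v) (1, 0))
        = integral (cbox 0 T) (\<lambda>u. integral (cbox 0 T) (\<lambda>v. P' (u, v) (1, 0)))"
      by (subst integral_prod_continuous) (use c in \<open>auto intro: continuous_on_subset simp: case_prod_unfold\<close>)
    moreover have "\<dots> = integral (cbox 0 T) (\<lambda>v. integral (cbox 0 T) (\<lambda>u. P' (u, v) (1, 0)))"
      by (rule integral_swap_continuous)
        (use c in \<open>auto intro: continuous_on_subset simp: case_prod_unfold\<close>)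
    ultimately show ?i1 by (simp add: case_prod_unfold)
  }
  {
    assume c: ?c2 and per: "\<And>u v. P (u, v + T) = P (u, v)"
    have "integral {0..T} (\<lambda>v. P' (u, v) (0, 1)) = 0" for u
    proof -
      have "((\<lambda>v. P (u, v)) has_vector_derivative P' (u, v) (0, 1)) (at v within {0..T})" for v
      proof -
        have "((\<lambda>v. (u, v)) has_derivative (\<lambda>d. d *\<^sub>R (0, 1))) (at v within {0..T})"
          by (auto intro!: derivative_eq_intros)
        from has_derivative_compose[OF this P] show ?thesis
          by (simp only: has_vector_derivative_def lin)
      qed
      from fundamental_theorem_of_calculus[OF T this]
      show ?thesis using per[of u 0] by (simp add: integral_unique)
    qed
    moreover have "integral (cbox (0, 0) (T, T)) (\<lambda>q. P' q (0, 1))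
        = integral (cbox 0 T) (\<lambda>u. integral (cbox 0 T) (\<lambda>v. P' (u, v) (0, 1)))"
      by (rule integral_prod_continuous) (use c in \<open>auto intro: continuous_on_subset\<close>)
    ultimately show ?i2 by simp
  }
qed

locale immersed_periodic_plane = immersed_plane f
  for f :: "real \<times> real \<Rightarrow> 'b::euclidean_space" +
  fixes T :: real
  assumes T_nonneg: "0 \<le> T"
    and periodic: "\<And>u v. f (u + T, v) = f (u, v)" "\<And>u v. f (u, v + T) = f (u, v)"
begin

lemma connection_coeff_periodic:
  assumes a: "\<And>q. f (q + a) = f q" and w: "w = \<partial> X (\<partial> Y f)"
  shows "connection_coeff w (q + a) = connection_coeff w q"
proof -
  have 1: "\<partial> X f (q + a) = \<partial> X f q" for X q by (rule along_periodic[OF smooth a])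
  have 2: "\<partial> X (\<partial> Y f) (q + a) = \<partial> X (\<partial> Y f) q" by (rule along_periodic[OF smooths(2) 1])
  show ?thesis unfolding connection_coeff_def \<delta>_def E_def F_def G_def w 1 2 ..
qed

text \<open>
  The connection form is built from derivatives of \<open>f\<close>, hence descends to the torus, where its
  exterior derivative integrates to zero.
\<close>

theorem gauss_bonnet_torus:
  "integral (cbox (0, 0) (T, T))
     (\<lambda>q. sectional_curvature (induced_metric f) q (1, 0) (0, 1) * sqrt (\<delta> q)) = 0"
proof -
  have per: "f (q + (T, 0)) = f q" "f (q + (0, T)) = f q" for q
    using periodic by (cases q; simp)+
  have "integral (cbox (0, 0) (T, T)) (\<lambda>q. connection_coeff_deriv f\<^sub>1\<^sub>1 q (0, 1)) = 0"
    by (rule integral_partial_periodic(2)[OF connection_coeff_has_derivative T_nonneg])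
      (auto intro!: smooths continuous_connection_coeff_deriv
        intro: connection_coeff_periodic[OF per(2), OF refl, where q = "(u, v)" for u v, simplified])
  moreover have "integral (cbox (0, 0) (T, T)) (\<lambda>q. connection_coeff_deriv f\<^sub>1\<^sub>2 q (1, 0)) = 0"
    by (rule integral_partial_periodic(1)[OF connection_coeff_has_derivative T_nonneg])
      (auto intro!: smooths continuous_connection_coeff_deriv
        intro: connection_coeff_periodic[OF per(1), OF refl, where q = "(u, v)" for u v, simplified])
  ultimately show ?thesis
    unfolding liouville_formula[symmetric]
    by (subst integral_diff)
      (auto intro!: integrable_continuous continuous_connection_coeff_deriv smooths)
qed

end

section \<open>Flatness of the ambient manifold\<close>

lemma sectional_curvature_constant_metric:
  assumes const: "\<And>q. g q = b" and nondegenerate: "\<And>w. (\<forall>Z. b w Z = 0) \<longleftrightarrow> w = 0"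
  shows "sectional_curvature g p X Y = 0"
proof -
  have sharp0: "sharp b (\<lambda>Z. 0) = 0"
    unfolding sharp_def by (rule the_equality) (use nondegenerate in auto)
  have "christoffel g q U V = 0" for q U V
    unfolding christoffel_def const by (simp add: sharp0)
  then have "riemann g p X Y Y = 0"
    by (simp add: riemann_def cov_deriv_def[abs_def])
  moreover have "b 0 X = 0" using nondegenerate[of 0] by simp
  ultimately show ?thesis by (simp add: sectional_curvature_def const)
qed

lemma along_covering: "\<partial> X covering q = (fst X, snd X *\<^sub>R (- sin (snd q), cos (snd q)))"
proof (rule along_eqI)
  show "(covering has_derivative (\<lambda>X. (fst X, snd X *\<^sub>R (- sin (snd q), cos (snd q))))) (at q)"
    unfolding covering_def[abs_def]
    by (auto intro!: derivative_eq_intros simp: fun_eq_iff)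
qed

lemma induced_metric_covering: "induced_metric covering q X Y = X \<bullet> Y"
proof -
  have "snd X * snd Y * (sin (snd q))\<^sup>2 + snd X * snd Y * (cos (snd q))\<^sup>2 = snd X * snd Y"
    by (metis distrib_left sin_cos_squared_add mult.right_neutral)
  then show ?thesis
    unfolding induced_metric_def frechet_derivative_eq_along along_covering
    by (simp add: inner_prod_def power2_eq_square algebra_simps)
qed

text \<open>
  Guarantees that the description which defines \<open>ambient_curvature\<close> is not vacuous.
\<close>

lemma covering_onto_tangent:
  assumes p: "p \<in> plane_circle"
  obtains q where "covering q = p" "\<And>V. V \<in> tangent_space p \<Longrightarrow> \<exists>X. \<partial> X covering q = V"
proof -
  obtain y c s where p': "p = (y, (c, s))" by (metis prod.exhaust)
  have "c\<^sup>2 + s\<^sup>2 = 1"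
    using p unfolding p' plane_circle_def by (simp add: norm_prod_def)
  then obtain \<theta> where \<theta>: "c = cos \<theta>" "s = sin \<theta>" by (metis sincos_total_2pi)
  have "covering (y, \<theta>) = p" by (simp add: covering_def p' \<theta>)
  moreover have "\<exists>X. \<partial> X covering (y, \<theta>) = V" if "V \<in> tangent_space p" for V
  proof -
    obtain a v w where V: "V = (a, (v, w))" by (metis prod.exhaust)
    have orth: "v * cos \<theta> + w * sin \<theta> = 0"
      using that unfolding V p' \<theta> tangent_space_def by simp
    have one: "sin \<theta> * sin \<theta> = 1 - cos \<theta> * cos \<theta>"
      using sin_cos_squared_add[of \<theta>] by (simp add: power2_eq_square)
    have "(w * cos \<theta> - v * sin \<theta>) * (- sin \<theta>) = v"
      using one orth by algebra
    moreover have "(w * cos \<theta> - v * sin \<theta>) * cos \<theta> = w"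
      using one orth by algebra
    ultimately have "\<partial> (a, w * cos \<theta> - v * sin \<theta>) covering (y, \<theta>) = V"
      by (simp add: along_covering V)
    then show ?thesis ..
  qed
  ultimately show thesis by (rule that)
qed

text \<open>
  In the coordinates of the universal covering the metric is the constant inner product.
\<close>

lemma ambient_curvature_zero:
  assumes p: "p \<in> plane_circle" and V: "V \<in> tangent_space p" and W: "W \<in> tangent_space p"
  shows "ambient_curvature p V W = 0"
proof -
  have flat: "sectional_curvature (induced_metric covering) q X Y = 0" for q X Y
  proof (rule sectional_curvature_constant_metric)
    show "induced_metric covering q = (\<bullet>)" for q
      by (intro ext) (rule induced_metric_covering)
    show "(\<forall>Z. w \<bullet> Z = 0) \<longleftrightarrow> w = 0" for w :: "plane \<times> real"
      by (metis inner_eq_zero_iff inner_zero_left)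
  qed
  obtain q where q: "covering q = p" "\<And>V. V \<in> tangent_space p \<Longrightarrow> \<exists>X. \<partial> X covering q = V"
    using covering_onto_tangent[OF p] by metis
  show ?thesis
    unfolding ambient_curvature_def frechet_derivative_eq_along flat
    using q(1) q(2)[OF V] q(2)[OF W] by (intro the_equality) blast+
qed

section \<open>Immersed tori in the product of the plane and the circle\<close>

lemma orth_proj_eqI:
  assumes S: "subspace S" and y: "y \<in> S" and orth: "\<And>z. z \<in> S \<Longrightarrow> (w - y) \<bullet> z = 0"
  shows "orth_proj S w = y"
  unfolding orth_proj_def
proof (rule the_equality)
  fix y' assume y': "y' \<in> S \<and> (\<forall>z\<in>S. (w - y') \<bullet> z = 0)"
  then have "y' - y \<in> S" using y S by (simp add: subspace_diff)
  then have "(w - y) \<bullet> (y' - y) = 0" "(w - y') \<bullet> (y' - y) = 0" using orth y' by auto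
  then have "(y' - y) \<bullet> (y' - y) = 0" by (simp add: inner_simps)
  then show "y' = y" by simp
qed (use y orth in auto)

lemma subspace_tangent_space: "subspace (tangent_space p)"
  by (auto simp: tangent_space_def subspace_def inner_simps mem_Times_iff)

lemma subspace_normal_space: "subspace (normal_space x p)"
  using subspace_tangent_space[of "x p"]
  by (auto simp: normal_space_def subspace_def inner_simps)

lemma periodic_representative:
  fixes f :: "real \<Rightarrow> 'a"
  assumes per: "\<And>u. f (u + T) = f u" and T: "T > 0"
  shows "\<exists>u'\<in>{0..T}. f u' = f u"
proof -
  have nat: "f (u + real n * T) = f u" for u n
  proof (induction n)
    case (Suc n)
    have "u + real (Suc n) * T = (u + real n * T) + T" by (simp add: algebra_simps)
    then show ?case using per Suc by metis
  qed simp
  have int: "f (u + of_int k * T) = f u" for u k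
  proof (cases "k \<ge> 0")
    case True
    then show ?thesis using nat[of u "nat k"] by simp
  next
    case False
    then have "(u + of_int k * T) + real (nat (- k)) * T = u" by simp
    then show ?thesis using nat[of "u + of_int k * T" "nat (- k)"] by metis
  qed
  have "f (T * frac (u / T)) = f u"
    using int[of u "- \<lfloor>u / T\<rfloor>"] T by (simp add: frac_def algebra_simps)
  moreover have "T * frac (u / T) \<in> {0..T}"
    using T frac_ge_0[of "u / T"] frac_lt_1[of "u / T"] by (simp add: mult_left_le)
  ultimately show ?thesis by blast
qed

text \<open>
  If \<open>d\<close> were positive, \<open>\<phi>'\<close> would be positive just to the right of its zero, and \<open>\<phi>\<close> would
  increase there.
\<close>

lemma second_derivative_at_max:
  fixes \<phi> :: "real \<Rightarrow> real"
  assumes \<phi>: "\<And>s. (\<phi> has_real_derivative \<phi>' s) (at s)"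
    and \<phi>': "(\<phi>' has_real_derivative d) (at 0)"
    and max: "\<And>s. \<phi> s \<le> \<phi> 0"
  shows "\<phi>' 0 = 0" "d \<le> 0"
proof -
  show zero: "\<phi>' 0 = 0"
    by (rule DERIV_local_max[OF \<phi> zero_less_one]) (use max in auto)
  show "d \<le> 0"
  proof (rule ccontr)
    assume "\<not> d \<le> 0"
    then obtain e where e: "e > 0" "\<And>h. 0 < h \<Longrightarrow> h < e \<Longrightarrow> \<phi>' 0 < \<phi>' h"
      using DERIV_pos_inc_right[OF \<phi>'] by auto
    have "\<exists>z>0. z < e / 2 \<and> \<phi> (e / 2) - \<phi> 0 = (e / 2 - 0) * \<phi>' z"
      using e(1) by (intro MVT2 \<phi>) auto
    then obtain z where z: "0 < z" "z < e / 2" "\<phi> (e / 2) - \<phi> 0 = e / 2 * \<phi>' z" by auto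
    then have "e / 2 * \<phi>' z > 0" using e(2)[of z] e(1) zero by simp
    with z(3) max[of "e / 2"] show False by simp
  qed
qed

locale immersed_torus = immersed_periodic_plane x "2 * pi"
  for x :: "real \<times> real \<Rightarrow> plane \<times> plane" +
  assumes in_plane_circle: "x q \<in> plane_circle"

lemma torus_immersion_iff: "torus_immersion x \<longleftrightarrow> immersed_torus x"
  unfolding torus_immersion_def immersed_torus_def immersed_torus_axioms_def
    immersed_periodic_plane_def immersed_periodic_plane_axioms_def immersed_plane_def
  by (auto simp: image_subset_iff)

context immersed_torus
begin

lemma circle_unit: "snd (x q) \<bullet> snd (x q) = 1"
  using in_plane_circle[of q] by (auto simp: plane_circle_def dot_square_norm mem_Times_iff)

text \<open>
  Differentiating \<open>|snd \<circ> x|\<^sup>2 = 1\<close>.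
\<close>

lemma along_tangent: "snd (\<partial> X x q) \<bullet> snd (x q) = 0"
proof -
  have "((\<lambda>q. snd (x q) \<bullet> snd (x q)) has_derivative
      (\<lambda>X. snd (x q) \<bullet> snd (\<partial> X x q) + snd (\<partial> X x q) \<bullet> snd (x q))) (at q)"
    by (intro has_derivative_inner has_derivative_snd smooth_has_derivative smooth)
  then have "((\<lambda>q. 1 :: real) has_derivative
      (\<lambda>X. snd (x q) \<bullet> snd (\<partial> X x q) + snd (\<partial> X x q) \<bullet> snd (x q))) (at q)"
    by (simp only: circle_unit)
  from fun_cong[OF has_derivative_unique[OF this has_derivative_const], of X]
  show ?thesis by (simp add: inner_commute[of "snd (x q)"])
qed

text \<open>
  The normal space of the surface in the ambient manifold arises from its normal space in
  \<open>plane \<times> plane\<close> by splitting off the unit normal \<open>(0, snd (x q))\<close> of the manifold, which is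
  orthogonal to the tangent plane of the surface as well.
\<close>

definition ambient_normal_part :: "real \<times> real \<Rightarrow> plane \<times> plane \<Rightarrow> plane \<times> plane"
  where "ambient_normal_part q w = normal_part q w - (snd w \<bullet> snd (x q)) *\<^sub>R (0, snd (x q))"

lemma second_ff_eq: "second_ff x p X Y = ambient_normal_part p (\<partial> X (\<partial> Y x) p)"
proof -
  define w where "w = \<partial> X (\<partial> Y x) p"
  define c where "c = snd w \<bullet> snd (x p)"
  have circle_direction: "(0, r) \<bullet> z = r \<bullet> snd z" for r :: plane and z :: "plane \<times> plane"
    by (cases z) (simp only: inner_Pair inner_zero_left add_0_left snd_conv)
  have "orth_proj (tangent_space (x p)) w = w - c *\<^sub>R (0, snd (x p))"
  proof (rule orth_proj_eqI[OF subspace_tangent_space])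
    show "w - c *\<^sub>R (0, snd (x p)) \<in> tangent_space (x p)"
      by (simp add: tangent_space_def mem_Times_iff inner_diff_left circle_unit c_def)
  next
    fix z assume "z \<in> tangent_space (x p)"
    then show "(w - (w - c *\<^sub>R (0, snd (x p)))) \<bullet> z = 0"
      by (simp add: tangent_space_def mem_Times_iff circle_direction
          inner_commute[of "snd (x p)"] del: scaleR_Pair)
  qed
  moreover have "orth_proj (normal_space x p) (w - c *\<^sub>R (0, snd (x p)))
      = normal_part p w - c *\<^sub>R (0, snd (x p))"
  proof (rule orth_proj_eqI[OF subspace_normal_space])
    have "(0, snd (x p)) \<bullet> \<partial> Z x p = 0" for Z
      by (simp only: circle_direction inner_commute[of "snd (x p)"] along_tangent)
    moreover have "snd (normal_part p w - c *\<^sub>R (0, snd (x p))) \<bullet> snd (x p) = 0"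
      by (simp add: normal_part_def inner_simps along_tangent circle_unit c_def)
    ultimately show "normal_part p w - c *\<^sub>R (0, snd (x p)) \<in> normal_space x p"
      unfolding normal_space_def frechet_derivative_eq_along
      by (simp add: tangent_space_def mem_Times_iff inner_diff_left normal_part_orthogonal
          del: snd_diff scaleR_Pair)
  next
    fix z assume "z \<in> normal_space x p"
    then have "\<partial> V x p \<bullet> z = 0" for V
      unfolding normal_space_def frechet_derivative_eq_along
      by (metis (mono_tags, lifting) inner_commute mem_Collect_eq)
    then show "(w - c *\<^sub>R (0, snd (x p)) - (normal_part p w - c *\<^sub>R (0, snd (x p)))) \<bullet> z = 0"
      by (simp add: normal_part_def)
  qed
  ultimately show ?thesis
    unfolding second_ff_def frechet_derivative_eq_along ambient_normal_part_def
    by (simp add: w_def[symmetric] c_def[symmetric])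
qed

lemma linear_ambient_normal_part: "linear (ambient_normal_part q)"
  unfolding ambient_normal_part_def
  by (intro linear_compose_sub linear_normal_part linearI)
    (simp_all add: inner_add_left scaleR_add_left del: scaleR_Pair)

lemma mean_curvature_eq: "mean_curvature x p =
    (1 / (2 * \<delta> p)) *\<^sub>R ambient_normal_part p (G p *\<^sub>R f\<^sub>1\<^sub>1 p - (2 * F p) *\<^sub>R f\<^sub>1\<^sub>2 p + E p *\<^sub>R f\<^sub>2\<^sub>2 p)"
proof -
  have sharp1: "sharp (induced_metric x p) (\<lambda>w. (1, 0) \<bullet> w) = (G p / \<delta> p, - F p / \<delta> p)"
    by (subst sharp_metric) auto
  have sharp2: "sharp (induced_metric x p) (\<lambda>w. (0, 1) \<bullet> w) = (- F p / \<delta> p, E p / \<delta> p)"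
    by (subst sharp_metric) auto
  have Basis: "(\<Sum>i\<in>Basis. h i) = h (1, 0) + h (0, 1)" for h :: "real \<times> real \<Rightarrow> plane \<times> plane"
    by (simp add: Basis_prod_def image_Un sum.union_disjoint)
  have "metric_trace (induced_metric x p) (second_ff x p) =
      ambient_normal_part p (\<partial> (1, 0) (\<partial> (G p / \<delta> p, - F p / \<delta> p) x) p
        + \<partial> (0, 1) (\<partial> (- F p / \<delta> p, E p / \<delta> p) x) p)"
    unfolding metric_trace_def Basis sharp1 sharp2 second_ff_eq
    by (simp add: linear_add[OF linear_ambient_normal_part])
  also have "\<partial> (1, 0) (\<partial> (G p / \<delta> p, - F p / \<delta> p) x) p + \<partial> (0, 1) (\<partial> (- F p / \<delta> p, E p / \<delta> p) x) p
      = (1 / \<delta> p) *\<^sub>R (G p *\<^sub>R f\<^sub>1\<^sub>1 p - (2 * F p) *\<^sub>R f\<^sub>1\<^sub>2 p + E p *\<^sub>R f\<^sub>2\<^sub>2 p)"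
  proof -
    have "\<partial> (1, 0) (\<partial> (G p / \<delta> p, - F p / \<delta> p) x) p
        = (G p / \<delta> p) *\<^sub>R f\<^sub>1\<^sub>1 p - (F p / \<delta> p) *\<^sub>R f\<^sub>1\<^sub>2 p"
      unfolding along_along_plane[OF smooth, of "(1, 0)" "(G p / \<delta> p, - F p / \<delta> p)"] by simp
    moreover have "\<partial> (0, 1) (\<partial> (- F p / \<delta> p, E p / \<delta> p) x) p
        = (E p / \<delta> p) *\<^sub>R f\<^sub>2\<^sub>2 p - (F p / \<delta> p) *\<^sub>R f\<^sub>1\<^sub>2 p"
      unfolding along_along_plane[OF smooth, of "(0, 1)" "(- F p / \<delta> p, E p / \<delta> p)"] by simp
    moreover have "(2 * F p / \<delta> p) *\<^sub>R f\<^sub>1\<^sub>2 p = (F p / \<delta> p) *\<^sub>R f\<^sub>1\<^sub>2 p + (F p / \<delta> p) *\<^sub>R f\<^sub>1\<^sub>2 p"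
      by (simp flip: scaleR_add_left)
    ultimately show ?thesis by (simp add: scaleR_add_right scaleR_diff_right)
  qed
  finally show ?thesis
    unfolding mean_curvature_def by (simp add: linear_scale[OF linear_ambient_normal_part])
qed

lemma continuous_mean_curvature: "continuous_on A (mean_curvature x)"
proof -
  have x: "continuous_on A x" "continuous_on A f\<^sub>1" "continuous_on A f\<^sub>2"
    "continuous_on A f\<^sub>1\<^sub>1" "continuous_on A f\<^sub>1\<^sub>2" "continuous_on A f\<^sub>2\<^sub>2"
    by (intro smooth_continuous smooths)+
  show ?thesis
    unfolding mean_curvature_eq[abs_def] ambient_normal_part_def normal_part_def
    unfolding along_f[of "tangential q w" for q w]
    unfolding tangential_def fst_conv snd_conv
    by (intro continuous_intros x) simp_all
qed

text \<open>
  Flatness removes the ambient curvature and Gauss-Bonnet removes the Gauss curvature.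
\<close>

lemma willmore_eq:
  "willmore x = integral (cbox (0, 0) (2 * pi, 2 * pi)) (\<lambda>p. (norm (mean_curvature x p))\<^sup>2 * sqrt (\<delta> p))"
proof -
  have "tangent_plane_curvature x p = 0" for p
    unfolding tangent_plane_curvature_def frechet_derivative_eq_along
    by (rule ambient_curvature_zero[OF in_plane_circle])
      (simp_all add: tangent_space_def mem_Times_iff along_tangent)
  then have "willmore x = integral (cbox (0, 0) (2 * pi, 2 * pi))
      (\<lambda>p. (norm (mean_curvature x p))\<^sup>2 * sqrt (\<delta> p)
        - sectional_curvature (induced_metric x) p (1, 0) (0, 1) * sqrt (\<delta> p))"
    unfolding willmore_def area_density_def gauss_curvature_def gram_det_eq
    by (simp add: algebra_simps)
  also have "\<dots> = integral (cbox (0, 0) (2 * pi, 2 * pi)) (\<lambda>p. (norm (mean_curvature x p))\<^sup>2 * sqrt (\<delta> p))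
      - integral (cbox (0, 0) (2 * pi, 2 * pi))
          (\<lambda>p. sectional_curvature (induced_metric x) p (1, 0) (0, 1) * sqrt (\<delta> p))"
    by (intro integral_diff integrable_continuous continuous_curvature)
      (intro continuous_intros continuous_mean_curvature)
  finally show ?thesis by (simp add: gauss_bonnet_torus)
qed

lemma fundamental_domain: "\<exists>q'\<in>cbox (0, 0) (2 * pi, 2 * pi). x q' = x q"
proof -
  obtain u where u: "u \<in> {0..2 * pi}" "x (u, snd q) = x (fst q, snd q)"
    using periodic_representative[of "\<lambda>u. x (u, snd q)" "2 * pi" "fst q"] periodic(1) by auto
  obtain v where v: "v \<in> {0..2 * pi}" "x (u, v) = x (u, snd q)"
    using periodic_representative[of "\<lambda>v. x (u, v)" "2 * pi" "snd q"] periodic(2) by auto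
  have "(u, v) \<in> cbox (0, 0) (2 * pi, 2 * pi)" using u v by (simp add: cbox_Pair_eq)
  then show ?thesis using u v by (metis prod.collapse)
qed

text \<open>
  Let \<open>p\<close> maximise \<open>|fst \<circ> x|\<^sup>2\<close>. The vector \<open>w = (fst (x p), 0)\<close> is then normal to the surface, so
  pairing it with second derivatives of \<open>x\<close> only sees the second fundamental form. The Hessian of
  half the function at \<open>p\<close> is \<open>|fst x\<^sub>X|\<^sup>2 + \<langle>w, x\<^sub>X\<^sub>X\<rangle> \<le> 0\<close>. The trace of \<open>\<langle>w, x\<^sub>X\<^sub>X\<rangle>\<close> is
  \<open>2 \<langle>w, H\<rangle>\<close>. Were \<open>H\<close> zero, the Hessian would have the trace of \<open>|fst x\<^sub>X|\<^sup>2\<close>, which is then both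
  nonnegative and nonpositive, so \<open>fst x\<^sub>X\<close> would vanish for all \<open>X\<close>. Then the tangent plane
  would be contained in the tangent line of the circle.
\<close>

lemma mean_curvature_nonzero_somewhere:
  "\<exists>p\<in>cbox (0, 0) (2 * pi, 2 * pi). mean_curvature x p \<noteq> 0"
proof -
  have cont: "continuous_on (cbox (0, 0) (2 * pi, 2 * pi)) (\<lambda>q. fst (x q) \<bullet> fst (x q))"
    by (intro continuous_intros smooth_continuous smooth)
  have nonempty: "cbox (0, 0) (2 * pi, 2 * pi) \<noteq> ({} :: (real \<times> real) set)"
    by (simp add: cbox_Pair_eq)
  obtain p where p: "p \<in> cbox (0, 0) (2 * pi, 2 * pi)"
    and p_max: "\<And>q. q \<in> cbox (0, 0) (2 * pi, 2 * pi) \<Longrightarrow> fst (x q) \<bullet> fst (x q) \<le> fst (x p) \<bullet> fst (x p)"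
    using continuous_attains_sup[OF compact_cbox nonempty cont] by blast
  have max: "fst (x q) \<bullet> fst (x q) \<le> fst (x p) \<bullet> fst (x p)" for q
    using fundamental_domain[of q] p_max by metis
  define w where "w = (fst (x p), 0 :: plane)"
  have "w \<bullet> \<partial> X x p = 0 \<and> fst (\<partial> X x p) \<bullet> fst (\<partial> X x p) + w \<bullet> \<partial> X (\<partial> X x) p \<le> 0" for X
  proof -
    let ?y = "\<lambda>s. fst (x (p + s *\<^sub>R X))" and ?y' = "\<lambda>s. fst (\<partial> X x (p + s *\<^sub>R X))"
    have y: "(?y has_vector_derivative ?y' s) (at s)" for s
      by (rule bounded_linear.has_vector_derivative[OF bounded_linear_fst
            smooth_vector_derivative_line[OF smooth]])
    have y': "(?y' has_vector_derivative fst (\<partial> X (\<partial> X x) (p + s *\<^sub>R X))) (at s)" for s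
      by (rule bounded_linear.has_vector_derivative[OF bounded_linear_fst
            smooth_vector_derivative_line[OF smooths(2)]])
    have "((\<lambda>s. ?y s \<bullet> ?y s) has_real_derivative 2 * (?y s \<bullet> ?y' s)) (at s)" for s
      using bounded_bilinear.has_vector_derivative[OF bounded_bilinear_inner y y, of s]
      by (simp add: has_real_derivative_iff_has_vector_derivative inner_commute)
    moreover have "((\<lambda>s. 2 * (?y s \<bullet> ?y' s)) has_real_derivative
        2 * (?y 0 \<bullet> fst (\<partial> X (\<partial> X x) (p + 0 *\<^sub>R X)) + ?y' 0 \<bullet> ?y' 0)) (at 0)"
      using bounded_bilinear.has_vector_derivative[OF bounded_bilinear_inner y y', of 0]
      by (intro DERIV_cmult) (simp add: has_real_derivative_iff_has_vector_derivative)
    moreover have "?y s \<bullet> ?y s \<le> ?y 0 \<bullet> ?y 0" for s using max by simp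
    ultimately have "2 * (?y 0 \<bullet> ?y' 0) = 0"
      "2 * (?y 0 \<bullet> fst (\<partial> X (\<partial> X x) (p + 0 *\<^sub>R X)) + ?y' 0 \<bullet> ?y' 0) \<le> 0"
      using second_derivative_at_max[of "\<lambda>s. ?y s \<bullet> ?y s" "\<lambda>s. 2 * (?y s \<bullet> ?y' s)"] by blast+
    then show ?thesis by (simp add: w_def inner_prod_def)
  qed
  then have crit: "w \<bullet> \<partial> X x p = 0"
    and hess: "fst (\<partial> X x p) \<bullet> fst (\<partial> X x p) + w \<bullet> \<partial> X (\<partial> X x) p \<le> 0" for X
    by auto
  have "mean_curvature x p \<noteq> 0"
  proof
    assume H: "mean_curvature x p = 0"
    define v where "v = G p *\<^sub>R f\<^sub>1\<^sub>1 p - (2 * F p) *\<^sub>R f\<^sub>1\<^sub>2 p + E p *\<^sub>R f\<^sub>2\<^sub>2 p"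
    \<comment> \<open>\<open>Y\<close> is orthogonal to \<open>(1, 0)\<close> in the induced metric, and their squared lengths are \<open>E \<delta>\<close> and
      \<open>E\<close>; so the Hessian in these two directions, with weights \<open>1\<close> and \<open>\<delta>\<close>, gives
      \<open>E \<delta>\<close> times the trace.\<close>
    define Y where "Y = (- F p, E p)"
    have "ambient_normal_part p v = 0"
      using H unfolding mean_curvature_eq v_def[symmetric] by simp
    moreover have "w \<bullet> ambient_normal_part p v = w \<bullet> v"
      by (simp add: ambient_normal_part_def normal_part_def inner_diff_right crit) (simp add: w_def)
    ultimately have wv: "w \<bullet> v = 0" by simp
    have "\<delta> p *\<^sub>R f\<^sub>1\<^sub>1 p + \<partial> Y (\<partial> Y x) p = E p *\<^sub>R v"
      unfolding along_along_plane[OF smooth, of Y Y]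
      by (simp add: Y_def v_def \<delta>_def power2_eq_square algebra_simps)
    then have "\<delta> p * (w \<bullet> f\<^sub>1\<^sub>1 p) + w \<bullet> \<partial> Y (\<partial> Y x) p = 0"
      using wv by (metis inner_add_right inner_scaleR_right mult_zero_right)
    moreover have "\<delta> p * (fst (f\<^sub>1 p) \<bullet> fst (f\<^sub>1 p) + w \<bullet> f\<^sub>1\<^sub>1 p) \<le> 0"
      using hess[of "(1, 0)"] \<delta>_pos[of p] by (simp add: mult_le_0_iff)
    ultimately have "\<delta> p * (fst (f\<^sub>1 p) \<bullet> fst (f\<^sub>1 p)) + fst (\<partial> Y x p) \<bullet> fst (\<partial> Y x p) \<le> 0"
      using hess[of Y] by (simp add: algebra_simps)
    moreover have "\<delta> p * (fst (f\<^sub>1 p) \<bullet> fst (f\<^sub>1 p)) \<ge> 0" "fst (\<partial> Y x p) \<bullet> fst (\<partial> Y x p) \<ge> 0"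
      using \<delta>_pos[of p] by simp_all
    ultimately have "\<delta> p * (fst (f\<^sub>1 p) \<bullet> fst (f\<^sub>1 p)) = 0" "fst (\<partial> Y x p) \<bullet> fst (\<partial> Y x p) = 0"
      by linarith+
    then have f1: "fst (f\<^sub>1 p) = 0" and "fst (\<partial> Y x p) = 0" by simp_all
    then have f2: "fst (f\<^sub>2 p) = 0"
      using E_pos[of p] unfolding along_f[of Y] by (simp add: Y_def)
    obtain a b where a: "snd (f\<^sub>1 p) = (a, b)" by fastforce
    obtain c d where c: "snd (f\<^sub>2 p) = (c, d)" by fastforce
    obtain m n where m: "snd (x p) = (m, n)" by fastforce
    have "m * m + n * n = 1" "a * m + b * n = 0" "c * m + d * n = 0"
      using circle_unit[of p] along_tangent[of "(1, 0)" p] along_tangent[of "(0, 1)" p]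
      by (simp_all add: a c m)
    then have "a * d - b * c = 0" by algebra
    moreover have "\<delta> p = (a * d - b * c)\<^sup>2"
      unfolding \<delta>_def E_def F_def G_def
      by (simp add: inner_prod_def f1 f2 a c power2_eq_square algebra_simps)
    ultimately show False using \<delta>_pos[of p] by simp
  qed
  with p show ?thesis by blast
qed

theorem willmore_pos: "willmore x > 0"
proof -
  let ?h = "\<lambda>p. (norm (mean_curvature x p))\<^sup>2 * sqrt (\<delta> p)"
    and ?B = "cbox (0, 0) (2 * pi, 2 * pi) :: (real \<times> real) set"
  have cont: "continuous_on ?B ?h" by (intro continuous_intros continuous_mean_curvature)
  have nonneg: "?h p \<ge> 0" for p using \<delta>_pos[of p] by simp
  obtain p where p: "p \<in> ?B" "mean_curvature x p \<noteq> 0"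
    using mean_curvature_nonzero_somewhere by blast
  have "integral ?B ?h \<noteq> 0"
  proof
    assume "integral ?B ?h = 0"
    then have "(?h has_integral 0) ?B"
      using integrable_integral[OF integrable_continuous[OF cont]] by simp
    moreover have "box (0, 0) (2 * pi, 2 * pi) \<noteq> ({} :: (real \<times> real) set)"
      by (simp add: box_ne_empty Basis_prod_def)
    ultimately have "?h p = 0"
      using has_integral_0_cbox_imp_0[OF cont] nonneg p(1) by blast
    then show False using p(2) \<delta>_pos[of p] by simp
  qed
  moreover have "integral ?B ?h \<ge> 0"
    by (rule integral_nonneg[OF integrable_continuous[OF cont]]) (rule nonneg)
  ultimately show ?thesis unfolding willmore_eq by simp
qed

end

section \<open>The product tori\<close>

text \<open>
  A family that contains the product tori and is closed under directional derivatives, which makes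
  smoothness an induction and all derivatives computable by simplification.
\<close>

definition trig :: "'b::euclidean_space \<Rightarrow> 'b \<Rightarrow> 'b \<Rightarrow> 'b \<Rightarrow> real \<times> real \<Rightarrow> 'b"
  where "trig A B C D q =
    cos (fst q) *\<^sub>R A + sin (fst q) *\<^sub>R B + cos (snd q) *\<^sub>R C + sin (snd q) *\<^sub>R D"

lemma trig_has_derivative: "(trig A B C D has_derivative
    (\<lambda>X. trig (fst X *\<^sub>R B) (- fst X *\<^sub>R A) (snd X *\<^sub>R D) (- snd X *\<^sub>R C) q)) (at q)"
  unfolding trig_def[abs_def]
  by (auto intro!: derivative_eq_intros simp: fun_eq_iff algebra_simps)

lemma along_trig:
  "\<partial> X (trig A B C D) = trig (fst X *\<^sub>R B) (- fst X *\<^sub>R A) (snd X *\<^sub>R D) (- snd X *\<^sub>R C)"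
  by (rule ext) (rule along_eqI[OF trig_has_derivative])

lemma smooth_trig: "smooth (trig A B C D)"
  unfolding smooth_def
proof
  show "C_k k (trig A B C D)" for k
  proof (induction k arbitrary: A B C D)
    case 0
    show ?case by (auto simp: trig_def[abs_def] intro!: continuous_intros)
  next
    case (Suc k)
    have "trig A B C D differentiable (at p)" for p
      using trig_has_derivative unfolding differentiable_def by blast
    then show ?case
      using Suc by (simp add: frechet_derivative_eq_along along_trig)
  qed
qed

lemma product_torus_trig:
  "product_torus t = trig ((t, 0), 0) ((0, t), 0) (0, (1, 0)) (0, (0, 1))"
  by (auto simp: product_torus_def trig_def fun_eq_iff zero_prod_def)

lemma immersed_product_torus:
  assumes "t > 0"
  shows "immersed_torus (product_torus t)"
proof
  show "smooth (product_torus t)" by (simp add: product_torus_trig smooth_trig)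
  show "inj (frechet_derivative (product_torus t) (at p))" for p
  proof -
    have lin: "linear (\<lambda>X. \<partial> X (product_torus t) p)"
      by (rule linear_along) (simp add: product_torus_trig smooth_trig)
    have "X = 0" if "\<partial> X (product_torus t) p = 0" for X
    proof -
      have 0: "t * fst X * sin (fst p) = 0" "t * fst X * cos (fst p) = 0"
        "snd X * sin (snd p) = 0" "snd X * cos (snd p) = 0"
        using that by (simp_all add: product_torus_trig along_trig trig_def zero_prod_def algebra_simps)
      have "fst X = 0" using 0(1,2) assms sin_zero_abs_cos_one[of "fst p"] by auto
      moreover have "snd X = 0" using 0(3,4) sin_zero_abs_cos_one[of "snd p"] by auto
      ultimately show "X = 0" by (simp add: prod_eq_iff)
    qed
    then have "inj (\<lambda>X. \<partial> X (product_torus t) p)"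
      using linear_injective_0[OF lin] by blast
    then show ?thesis by (simp add: along_def)
  qed
  show "product_torus t q \<in> plane_circle" for q
    by (cases q) (simp add: product_torus_def plane_circle_def norm_prod_def)
qed (simp_all add: product_torus_def)

lemma willmore_product_torus:
  assumes t: "t > 0"
  shows "willmore (product_torus t) = pi\<^sup>2 / t"
proof -
  interpret immersed_torus "product_torus t" by (rule immersed_product_torus[OF t])
  note trigs = product_torus_trig along_trig trig_def
  have sc: "sin r * sin r + cos r * cos r = 1" "cos r * cos r + sin r * sin r = 1" for r :: real
    using sin_cos_squared_add[of r] by (simp_all add: power2_eq_square)
  have E: "E q = t\<^sup>2" for q
  proof -
    have "t * (t * (cos r * cos r)) + t * (t * (sin r * sin r)) = t * t" for r
      using sc(2)[of r] by algebra
    then show ?thesis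
      unfolding E_def by (simp add: trigs inner_prod_def power2_eq_square algebra_simps)
  qed
  have F: "F q = 0" for q
    unfolding F_def by (simp add: trigs inner_prod_def)
  have G: "G q = 1" for q
    unfolding G_def by (simp add: trigs inner_prod_def sc)
  have \<delta>: "\<delta> q = t\<^sup>2" for q by (simp add: \<delta>_def E F G)
  have "(norm (mean_curvature (product_torus t) q))\<^sup>2 = 1 / (4 * t\<^sup>2)" for q
  proof -
    define w where "w = f\<^sub>1\<^sub>1 q + t\<^sup>2 *\<^sub>R f\<^sub>2\<^sub>2 q"
    define c where "c = (cos (fst q), sin (fst q))"
    define e where "e = (cos (snd q), sin (snd q))"
    have w: "w = (- t *\<^sub>R c, - t\<^sup>2 *\<^sub>R e)"
      by (simp add: w_def c_def e_def trigs)
    have x: "snd (product_torus t q) = e" by (simp add: e_def product_torus_def split_beta)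
    have "w \<bullet> f\<^sub>1 q = 0" "w \<bullet> f\<^sub>2 q = 0"
      by (simp_all add: w c_def e_def trigs inner_prod_def)
    then have "tangential q w = 0" by (simp add: tangential_def prod_eq_iff)
    then have "normal_part q w = w" by (simp add: normal_part_def along_eq_0_iff)
    moreover have "e \<bullet> e = 1" by (simp add: e_def sc)
    then have "snd w \<bullet> e = - t\<^sup>2" by (simp add: w)
    ultimately have "ambient_normal_part q w = (- t *\<^sub>R c, 0)"
      by (simp add: ambient_normal_part_def x) (simp add: w)
    then have "mean_curvature (product_torus t) q = (1 / (2 * t\<^sup>2)) *\<^sub>R (- t *\<^sub>R c, 0)"
      by (simp add: mean_curvature_eq E F G \<delta> w_def)
    moreover have "norm c = 1" by (simp add: c_def norm_prod_def)
    ultimately show ?thesis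
      using t by (simp add: norm_prod_def power2_eq_square field_simps)
  qed
  then have "willmore (product_torus t) =
      integral (cbox (0, 0) (2 * pi, 2 * pi)) (\<lambda>p :: real \<times> real. 1 / (4 * t\<^sup>2) * sqrt (t\<^sup>2))"
    by (simp add: willmore_eq \<delta>)
  also have "\<dots> = pi\<^sup>2 / t"
    using t by (simp add: content_Pair power2_eq_square field_simps)
  finally show ?thesis .
qed

theorem theorem4p4:
  "(\<forall>x. torus_immersion x \<longrightarrow> willmore x > 0) \<and>
   (\<forall>t>0. torus_immersion (product_torus t) \<and> willmore (product_torus t) = pi\<^sup>2 / t) \<and>
   ((\<lambda>t. willmore (product_torus t)) \<longlongrightarrow> 0) at_top \<and>
   \<not> (\<exists>x. torus_immersion x \<and> (\<forall>y. torus_immersion y \<longrightarrow> willmore x \<le> willmore y))"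
proof (intro conjI)
  show pos: "\<forall>x. torus_immersion x \<longrightarrow> willmore x > 0"
    using immersed_torus.willmore_pos torus_immersion_iff by blast
  show prod: "\<forall>t>0. torus_immersion (product_torus t) \<and> willmore (product_torus t) = pi\<^sup>2 / t"
    using immersed_product_torus willmore_product_torus torus_immersion_iff by blast
  have "((\<lambda>t. pi\<^sup>2 / t) \<longlongrightarrow> 0) at_top"
    by (intro tendsto_divide_0[OF tendsto_const] filterlim_at_top_imp_at_infinity filterlim_ident)
  moreover have "\<forall>\<^sub>F t in at_top. pi\<^sup>2 / t = willmore (product_torus t)"
    using eventually_gt_at_top[of 0] by eventually_elim (simp add: prod)
  ultimately show lim: "((\<lambda>t. willmore (product_torus t)) \<longlongrightarrow> 0) at_top"
    by (rule Lim_transform_eventually)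
  show "\<not> (\<exists>x. torus_immersion x \<and> (\<forall>y. torus_immersion y \<longrightarrow> willmore x \<le> willmore y))"
  proof
    assume "\<exists>x. torus_immersion x \<and> (\<forall>y. torus_immersion y \<longrightarrow> willmore x \<le> willmore y)"
    then obtain x where x: "torus_immersion x" "\<And>y. torus_immersion y \<Longrightarrow> willmore x \<le> willmore y"
      by blast
    have "\<forall>\<^sub>F t in at_top. willmore (product_torus t) < willmore x \<and> t > 0"
      using order_tendstoD(2)[OF lim, of "willmore x"] pos x(1)
      by (intro eventually_conj eventually_gt_at_top) auto
    then obtain t where "willmore (product_torus t) < willmore x" "t > 0"
      using eventually_happens'[OF trivial_limit_at_top_linorder] by blast
    then show False using x(2)[of "product_torus t"] prod by fastforce
  qed
qed

end
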